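(* Let $\mathbf{MonCAT}_\ell$ be the 2-category of large monoidal categories, lax monoidal functors and monoidal natural transformations, and let $\mathrm{Enr}\colon\mathbf{MonCAT}_\ell\to2\text{-}\mathbf{CAT}$ be the 2-functor sending $\mathcal V$ to the 2-category $\mathcal V\text{-}\mathbf{Cat}$ of small $\mathcal V$-categories, $\mathcal V$-functors and $\mathcal V$-natural transformations. Then the 2-functor $\mathrm{Enr}_1\colon\mathbf{MonCAT}_\ell\to2\text{-}\mathbf{CAT}/\mathrm{Enr}(1)=2\text{-}\mathbf{CAT}/\mathbf{Set}_{\mathrm{lc}}$, $\mathcal V\mapsto(\mathrm{Enr}(!_{\mathcal V})\colon\mathcal V\text{-}\mathbf{Cat}\to\mathbf{Set}_{\mathrm{lc}})$, does not preserve all equalizers that exist in $\mathbf{MonCAT}_\ell$: there is a parallel pair in $\mathbf{MonCAT}_\ell$ which has an equalizer that is not preserved by $\mathrm{Enr}_1$. Consequently $\mathrm{Enr}\colon\mathbf{MonCAT}_\ell\to2\text{-}\mathbf{CAT}$ is not a parametric right 2-adjoint.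
   Context: Size: fix Grothendieck universes $\mathcal U_1\in\mathcal U_2$; small means in $\mathcal U_1$, large means in $\mathcal U_2$. $2\text{-}\mathbf{CAT}$ is the 2-category of large 2-categories, 2-functors and 2-natural transformations; slices are strict slice 2-categories. $\mathbf{Set}_{\mathrm{lc}}$ is the 2-category whose underlying category is the category of small sets and which has exactly one 2-cell between any two parallel functions; $\mathrm{Enr}(1)=\mathbf{Set}_{\mathrm{lc}}$ for the terminal monoidal category $1$. For a 2-category $\mathscr K$ with a terminal object $1$, a 2-functor $R\colon\mathscr K\to\mathscr L$ is a parametric right 2-adjoint if $R_1\colon\mathscr K\to\mathscr L/R1$, $K\mapsto(R!_K\colon RK\to R1)$, has a left 2-adjoint. *)

theory Defs
  imports "HOL-Library.FuncSet"
begin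

section \<open>Grothendieck universes\<close>

text \<open>
  The ambient sets are the elements of a type \<open>'v\<close>; the HOL set \<open>el x\<close> is the extension of the
  set \<open>x\<close>. The second clause of \<open>grothendieck_universe\<close> is separation in the ambient set theory
  together with closure under subsets; the last one excludes the empty universe and the universe
  of hereditarily finite sets.
\<close>

definition in_universe :: "('v \<Rightarrow> 'v set) \<Rightarrow> 'v \<Rightarrow> 'v set \<Rightarrow> bool" where
  "in_universe el U S \<longleftrightarrow> (\<exists>x\<in>el U. el x = S)"

definition grothendieck_universe :: "('v \<Rightarrow> 'v set) \<Rightarrow> 'v \<Rightarrow> bool" where
  "grothendieck_universe el U \<longleftrightarrow>
     (\<forall>x\<in>el U. el x \<subseteq> el U) \<and>
     (\<forall>x\<in>el U. \<forall>S. S \<subseteq> el x \<longrightarrow> in_universe el U S) \<and>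
     (\<forall>x\<in>el U. \<forall>y\<in>el U. in_universe el U {x, y}) \<and>
     (\<forall>x\<in>el U. in_universe el U {y. el y \<subseteq> el x}) \<and>
     (\<forall>I\<in>el U. \<forall>f. f ` el I \<subseteq> el U \<longrightarrow> in_universe el U (\<Union>i\<in>el I. el (f i))) \<and>
     (\<exists>x\<in>el U. infinite (el x))"

definition nested_universes :: "('v \<Rightarrow> 'v set) \<Rightarrow> 'v \<Rightarrow> 'v \<Rightarrow> bool" where
  "nested_universes el U1 U2 \<longleftrightarrow>
     inj el \<and> grothendieck_universe el U1 \<and> grothendieck_universe el U2 \<and> U1 \<in> el U2"

text \<open>
  Sets of records (such as the set of all small \<open>\<V>\<close>-categories) do not live in the type \<open>'v\<close>.
  They are large if they are in bijection with an element of \<open>U2\<close>.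
\<close>

definition universe_sized :: "('v \<Rightarrow> 'v set) \<Rightarrow> 'v \<Rightarrow> 'a set \<Rightarrow> bool" where
  "universe_sized el U S \<longleftrightarrow> (\<exists>x\<in>el U. \<exists>f. bij_betw f S (el x))"


section \<open>Strict 2-categories\<close>

text \<open>
  In all structures below, operations take the value \<open>undefined\<close> outside their domain, so that
  equality of records is equality of the structures they represent. \<open>Comp1 C g f\<close>,
  \<open>VComp C \<beta> \<alpha>\<close> and \<open>HComp C \<beta> \<alpha>\<close> are written in the order of function composition.
\<close>

record ('o, 'a, 'c) two_cat =
  Cell0 :: "'o set"
  Cell1 :: "'a set"
  Cell2 :: "'c set"
  Src1 :: "'a \<Rightarrow> 'o"
  Trg1 :: "'a \<Rightarrow> 'o"
  Src2 :: "'c \<Rightarrow> 'a"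
  Trg2 :: "'c \<Rightarrow> 'a"
  Id1 :: "'o \<Rightarrow> 'a"
  Comp1 :: "'a \<Rightarrow> 'a \<Rightarrow> 'a"
  Id2 :: "'a \<Rightarrow> 'c"
  VComp :: "'c \<Rightarrow> 'c \<Rightarrow> 'c"
  HComp :: "'c \<Rightarrow> 'c \<Rightarrow> 'c"

definition hom1 :: "('o, 'a, 'c) two_cat \<Rightarrow> 'o \<Rightarrow> 'o \<Rightarrow> 'a set" where
  "hom1 C x y = {f \<in> Cell1 C. Src1 C f = x \<and> Trg1 C f = y}"

definition hom2 :: "('o, 'a, 'c) two_cat \<Rightarrow> 'a \<Rightarrow> 'a \<Rightarrow> 'c set" where
  "hom2 C f g = {\<alpha> \<in> Cell2 C. Src2 C \<alpha> = f \<and> Trg2 C \<alpha> = g}"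

definition composable1 :: "('o, 'a, 'c) two_cat \<Rightarrow> 'a \<Rightarrow> 'a \<Rightarrow> bool" where
  "composable1 C g f \<longleftrightarrow> f \<in> Cell1 C \<and> g \<in> Cell1 C \<and> Src1 C g = Trg1 C f"

definition vcomposable :: "('o, 'a, 'c) two_cat \<Rightarrow> 'c \<Rightarrow> 'c \<Rightarrow> bool" where
  "vcomposable C \<beta> \<alpha> \<longleftrightarrow> \<alpha> \<in> Cell2 C \<and> \<beta> \<in> Cell2 C \<and> Src2 C \<beta> = Trg2 C \<alpha>"

definition hcomposable :: "('o, 'a, 'c) two_cat \<Rightarrow> 'c \<Rightarrow> 'c \<Rightarrow> bool" where
  "hcomposable C \<beta> \<alpha> \<longleftrightarrow>
     \<alpha> \<in> Cell2 C \<and> \<beta> \<in> Cell2 C \<and> Src1 C (Src2 C \<beta>) = Trg1 C (Src2 C \<alpha>)"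

locale two_category =
  fixes C :: "('o, 'a, 'c) two_cat"
  assumes src1: "f \<in> Cell1 C \<Longrightarrow> Src1 C f \<in> Cell0 C"
    and trg1: "f \<in> Cell1 C \<Longrightarrow> Trg1 C f \<in> Cell0 C"
    and id1: "x \<in> Cell0 C \<Longrightarrow> Id1 C x \<in> hom1 C x x"
    and comp1: "f \<in> hom1 C x y \<Longrightarrow> g \<in> hom1 C y z \<Longrightarrow> Comp1 C g f \<in> hom1 C x z"
    and comp1_id_right: "f \<in> hom1 C x y \<Longrightarrow> Comp1 C f (Id1 C x) = f"
    and comp1_id_left: "f \<in> hom1 C x y \<Longrightarrow> Comp1 C (Id1 C y) f = f"
    and comp1_assoc:
      "f \<in> hom1 C w x \<Longrightarrow> g \<in> hom1 C x y \<Longrightarrow> h \<in> hom1 C y z \<Longrightarrow>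
        Comp1 C h (Comp1 C g f) = Comp1 C (Comp1 C h g) f"
    and src2: "\<alpha> \<in> Cell2 C \<Longrightarrow> Src2 C \<alpha> \<in> Cell1 C"
    and trg2: "\<alpha> \<in> Cell2 C \<Longrightarrow> Trg2 C \<alpha> \<in> Cell1 C"
    and globular_src: "\<alpha> \<in> Cell2 C \<Longrightarrow> Src1 C (Src2 C \<alpha>) = Src1 C (Trg2 C \<alpha>)"
    and globular_trg: "\<alpha> \<in> Cell2 C \<Longrightarrow> Trg1 C (Src2 C \<alpha>) = Trg1 C (Trg2 C \<alpha>)"
    and id2: "f \<in> Cell1 C \<Longrightarrow> Id2 C f \<in> hom2 C f f"
    and vcomp: "\<alpha> \<in> hom2 C f g \<Longrightarrow> \<beta> \<in> hom2 C g h \<Longrightarrow> VComp C \<beta> \<alpha> \<in> hom2 C f h"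
    and vcomp_id_right: "\<alpha> \<in> hom2 C f g \<Longrightarrow> VComp C \<alpha> (Id2 C f) = \<alpha>"
    and vcomp_id_left: "\<alpha> \<in> hom2 C f g \<Longrightarrow> VComp C (Id2 C g) \<alpha> = \<alpha>"
    and vcomp_assoc:
      "\<alpha> \<in> hom2 C f g \<Longrightarrow> \<beta> \<in> hom2 C g h \<Longrightarrow> \<gamma> \<in> hom2 C h k \<Longrightarrow>
        VComp C \<gamma> (VComp C \<beta> \<alpha>) = VComp C (VComp C \<gamma> \<beta>) \<alpha>"
    and hcomp:
      "\<alpha> \<in> hom2 C f f' \<Longrightarrow> \<beta> \<in> hom2 C g g' \<Longrightarrow> f \<in> hom1 C x y \<Longrightarrow> g \<in> hom1 C y z \<Longrightarrow>
        HComp C \<beta> \<alpha> \<in> hom2 C (Comp1 C g f) (Comp1 C g' f')"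
    and hcomp_id2:
      "f \<in> hom1 C x y \<Longrightarrow> g \<in> hom1 C y z \<Longrightarrow>
        HComp C (Id2 C g) (Id2 C f) = Id2 C (Comp1 C g f)"
    and interchange:
      "\<alpha> \<in> hom2 C f f' \<Longrightarrow> \<alpha>' \<in> hom2 C f' f'' \<Longrightarrow> \<beta> \<in> hom2 C g g' \<Longrightarrow> \<beta>' \<in> hom2 C g' g'' \<Longrightarrow>
        f \<in> hom1 C x y \<Longrightarrow> g \<in> hom1 C y z \<Longrightarrow>
        HComp C (VComp C \<beta>' \<beta>) (VComp C \<alpha>' \<alpha>) = VComp C (HComp C \<beta>' \<alpha>') (HComp C \<beta> \<alpha>)"
    and hcomp_id_right:
      "\<alpha> \<in> hom2 C f g \<Longrightarrow> f \<in> hom1 C x y \<Longrightarrow> HComp C \<alpha> (Id2 C (Id1 C x)) = \<alpha>"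
    and hcomp_id_left:
      "\<alpha> \<in> hom2 C f g \<Longrightarrow> f \<in> hom1 C x y \<Longrightarrow> HComp C (Id2 C (Id1 C y)) \<alpha> = \<alpha>"
    and hcomp_assoc:
      "\<alpha> \<in> hom2 C f f' \<Longrightarrow> \<beta> \<in> hom2 C g g' \<Longrightarrow> \<gamma> \<in> hom2 C h h' \<Longrightarrow>
        f \<in> hom1 C w x \<Longrightarrow> g \<in> hom1 C x y \<Longrightarrow> h \<in> hom1 C y z \<Longrightarrow>
        HComp C \<gamma> (HComp C \<beta> \<alpha>) = HComp C (HComp C \<gamma> \<beta>) \<alpha>"
    and ext_src1: "Src1 C \<in> extensional (Cell1 C)"
    and ext_trg1: "Trg1 C \<in> extensional (Cell1 C)"
    and ext_src2: "Src2 C \<in> extensional (Cell2 C)"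
    and ext_trg2: "Trg2 C \<in> extensional (Cell2 C)"
    and ext_id1: "Id1 C \<in> extensional (Cell0 C)"
    and ext_id2: "Id2 C \<in> extensional (Cell1 C)"
    and ext_comp1: "\<not> composable1 C g f \<Longrightarrow> Comp1 C g f = undefined"
    and ext_vcomp: "\<not> vcomposable C \<beta> \<alpha> \<Longrightarrow> VComp C \<beta> \<alpha> = undefined"
    and ext_hcomp: "\<not> hcomposable C \<beta> \<alpha> \<Longrightarrow> HComp C \<beta> \<alpha> = undefined"


section \<open>2-functors and 2-natural transformations\<close>

record ('o, 'a, 'c, 'p, 'b, 'd) two_fun =
  FSrc :: "('o, 'a, 'c) two_cat"
  FTrg :: "('p, 'b, 'd) two_cat"
  F0 :: "'o \<Rightarrow> 'p"
  F1 :: "'a \<Rightarrow> 'b"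
  F2 :: "'c \<Rightarrow> 'd"

definition two_functor :: "('o, 'a, 'c, 'p, 'b, 'd) two_fun \<Rightarrow> bool" where
  "two_functor F \<longleftrightarrow>
     (let C = FSrc F; D = FTrg F in
       two_category C \<and> two_category D \<and>
       F0 F \<in> Cell0 C \<rightarrow>\<^sub>E Cell0 D \<and> F1 F \<in> Cell1 C \<rightarrow>\<^sub>E Cell1 D \<and> F2 F \<in> Cell2 C \<rightarrow>\<^sub>E Cell2 D \<and>
       (\<forall>f\<in>Cell1 C. Src1 D (F1 F f) = F0 F (Src1 C f) \<and> Trg1 D (F1 F f) = F0 F (Trg1 C f)) \<and>
       (\<forall>\<alpha>\<in>Cell2 C. Src2 D (F2 F \<alpha>) = F1 F (Src2 C \<alpha>) \<and> Trg2 D (F2 F \<alpha>) = F1 F (Trg2 C \<alpha>)) \<and>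
       (\<forall>x\<in>Cell0 C. F1 F (Id1 C x) = Id1 D (F0 F x)) \<and>
       (\<forall>f\<in>Cell1 C. F2 F (Id2 C f) = Id2 D (F1 F f)) \<and>
       (\<forall>f g. composable1 C g f \<longrightarrow> F1 F (Comp1 C g f) = Comp1 D (F1 F g) (F1 F f)) \<and>
       (\<forall>\<alpha> \<beta>. vcomposable C \<beta> \<alpha> \<longrightarrow> F2 F (VComp C \<beta> \<alpha>) = VComp D (F2 F \<beta>) (F2 F \<alpha>)) \<and>
       (\<forall>\<alpha> \<beta>. hcomposable C \<beta> \<alpha> \<longrightarrow> F2 F (HComp C \<beta> \<alpha>) = HComp D (F2 F \<beta>) (F2 F \<alpha>)))"

definition id_fun :: "('o, 'a, 'c) two_cat \<Rightarrow> ('o, 'a, 'c, 'o, 'a, 'c) two_fun" where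
  "id_fun C = \<lparr>FSrc = C, FTrg = C,
     F0 = (\<lambda>x\<in>Cell0 C. x), F1 = (\<lambda>f\<in>Cell1 C. f), F2 = (\<lambda>\<alpha>\<in>Cell2 C. \<alpha>)\<rparr>"

definition comp_fun ::
  "('p, 'b, 'd, 'q, 'e, 'f) two_fun \<Rightarrow> ('o, 'a, 'c, 'p, 'b, 'd) two_fun \<Rightarrow>
   ('o, 'a, 'c, 'q, 'e, 'f) two_fun" where
  "comp_fun G F = \<lparr>FSrc = FSrc F, FTrg = FTrg G,
     F0 = (\<lambda>x\<in>Cell0 (FSrc F). F0 G (F0 F x)),
     F1 = (\<lambda>f\<in>Cell1 (FSrc F). F1 G (F1 F f)),
     F2 = (\<lambda>\<alpha>\<in>Cell2 (FSrc F). F2 G (F2 F \<alpha>))\<rparr>"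

record ('o, 'a, 'c, 'p, 'b, 'd) two_nt =
  NSrc :: "('o, 'a, 'c, 'p, 'b, 'd) two_fun"
  NTrg :: "('o, 'a, 'c, 'p, 'b, 'd) two_fun"
  NCmp :: "'o \<Rightarrow> 'b"

definition two_natural :: "('o, 'a, 'c, 'p, 'b, 'd) two_nt \<Rightarrow> bool" where
  "two_natural \<eta> \<longleftrightarrow>
     (let F = NSrc \<eta>; G = NTrg \<eta>; C = FSrc F; D = FTrg F in
       two_functor F \<and> two_functor G \<and> FSrc G = C \<and> FTrg G = D \<and>
       NCmp \<eta> \<in> extensional (Cell0 C) \<and>
       (\<forall>x\<in>Cell0 C. NCmp \<eta> x \<in> hom1 D (F0 F x) (F0 G x)) \<and>
       (\<forall>f\<in>Cell1 C.
          Comp1 D (F1 G f) (NCmp \<eta> (Src1 C f)) = Comp1 D (NCmp \<eta> (Trg1 C f)) (F1 F f)) \<and>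
       (\<forall>\<alpha>\<in>Cell2 C.
          HComp D (F2 G \<alpha>) (Id2 D (NCmp \<eta> (Src1 C (Src2 C \<alpha>)))) =
          HComp D (Id2 D (NCmp \<eta> (Trg1 C (Src2 C \<alpha>)))) (F2 F \<alpha>)))"


section \<open>The 2-category of large 2-categories\<close>

text \<open>
  The cells of the objects of \<open>TwoCAT\<close> are drawn from three fixed types. If these types are at
  least as big as \<open>'v\<close>, every large 2-category is isomorphic to an object of \<open>TwoCAT\<close>.
\<close>

definition large_two_cats :: "('v \<Rightarrow> 'v set) \<Rightarrow> 'v \<Rightarrow> ('o, 'a, 'c) two_cat set" where
  "large_two_cats el U = {C. two_category C \<and>
     universe_sized el U (Cell0 C) \<and> universe_sized el U (Cell1 C) \<and>
     universe_sized el U (Cell2 C)}"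

definition large_two_funs :: "('v \<Rightarrow> 'v set) \<Rightarrow> 'v \<Rightarrow> ('o, 'a, 'c, 'o, 'a, 'c) two_fun set" where
  "large_two_funs el U =
     {F. two_functor F \<and> FSrc F \<in> large_two_cats el U \<and> FTrg F \<in> large_two_cats el U}"

definition large_two_nts :: "('v \<Rightarrow> 'v set) \<Rightarrow> 'v \<Rightarrow> ('o, 'a, 'c, 'o, 'a, 'c) two_nt set" where
  "large_two_nts el U = {\<eta>. two_natural \<eta> \<and>
     NSrc \<eta> \<in> large_two_funs el U \<and> NTrg \<eta> \<in> large_two_funs el U}"

definition TwoCAT ::
  "('v \<Rightarrow> 'v set) \<Rightarrow> 'v \<Rightarrow>
   (('o, 'a, 'c) two_cat, ('o, 'a, 'c, 'o, 'a, 'c) two_fun, ('o, 'a, 'c, 'o, 'a, 'c) two_nt)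
     two_cat" where
  "TwoCAT el U = \<lparr>
     Cell0 = large_two_cats el U,
     Cell1 = large_two_funs el U,
     Cell2 = large_two_nts el U,
     Src1 = (\<lambda>F\<in>large_two_funs el U. FSrc F),
     Trg1 = (\<lambda>F\<in>large_two_funs el U. FTrg F),
     Src2 = (\<lambda>\<eta>\<in>large_two_nts el U. NSrc \<eta>),
     Trg2 = (\<lambda>\<eta>\<in>large_two_nts el U. NTrg \<eta>),
     Id1 = (\<lambda>C\<in>large_two_cats el U. id_fun C),
     Comp1 = (\<lambda>G F.
       if F \<in> large_two_funs el U \<and> G \<in> large_two_funs el U \<and> FSrc G = FTrg F
       then comp_fun G F else undefined),
     Id2 = (\<lambda>F\<in>large_two_funs el U.
       \<lparr>NSrc = F, NTrg = F, NCmp = (\<lambda>x\<in>Cell0 (FSrc F). Id1 (FTrg F) (F0 F x))\<rparr>),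
     VComp = (\<lambda>\<tau> \<sigma>.
       if \<sigma> \<in> large_two_nts el U \<and> \<tau> \<in> large_two_nts el U \<and> NSrc \<tau> = NTrg \<sigma>
       then \<lparr>NSrc = NSrc \<sigma>, NTrg = NTrg \<tau>,
              NCmp = (\<lambda>x\<in>Cell0 (FSrc (NSrc \<sigma>)).
                Comp1 (FTrg (NSrc \<sigma>)) (NCmp \<tau> x) (NCmp \<sigma> x))\<rparr>
       else undefined),
     HComp = (\<lambda>\<tau> \<sigma>.
       if \<sigma> \<in> large_two_nts el U \<and> \<tau> \<in> large_two_nts el U \<and> FSrc (NSrc \<tau>) = FTrg (NSrc \<sigma>)
       then \<lparr>NSrc = comp_fun (NSrc \<tau>) (NSrc \<sigma>), NTrg = comp_fun (NTrg \<tau>) (NTrg \<sigma>),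
              NCmp = (\<lambda>x\<in>Cell0 (FSrc (NSrc \<sigma>)).
                Comp1 (FTrg (NSrc \<tau>))
                  (NCmp \<tau> (F0 (NTrg \<sigma>) x)) (F1 (NSrc \<tau>) (NCmp \<sigma> x)))\<rparr>
       else undefined)\<rparr>"


section \<open>Slices, equalizers, terminal objects, 2-adjoints, parametric right 2-adjoints\<close>

text \<open>
  The strict slice over \<open>X\<close>: a 1-cell from \<open>p\<close> to \<open>q\<close> is a triple \<open>(p, q, h)\<close> with \<open>q h = p\<close>, and a
  2-cell from \<open>h\<close> to \<open>k\<close> is a 2-cell of the given 2-category whose whiskering with \<open>q\<close> is the
  identity.
\<close>

definition slice1 :: "('o, 'a, 'c) two_cat \<Rightarrow> 'o \<Rightarrow> ('a \<times> 'a \<times> 'a) set" where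
  "slice1 L X = {(p, q, h). p \<in> Cell1 L \<and> q \<in> Cell1 L \<and> Trg1 L p = X \<and> Trg1 L q = X \<and>
     h \<in> hom1 L (Src1 L p) (Src1 L q) \<and> Comp1 L q h = p}"

definition slice2 ::
  "('o, 'a, 'c) two_cat \<Rightarrow> 'o \<Rightarrow> (('a \<times> 'a \<times> 'a) \<times> ('a \<times> 'a \<times> 'a) \<times> 'c) set" where
  "slice2 L X = {((p, q, h), (p', q', k), \<theta>).
     (p, q, h) \<in> slice1 L X \<and> (p', q', k) \<in> slice1 L X \<and> p = p' \<and> q = q' \<and>
     \<theta> \<in> hom2 L h k \<and> HComp L (Id2 L q) \<theta> = Id2 L p}"

definition slice ::
  "('o, 'a, 'c) two_cat \<Rightarrow> 'o \<Rightarrow>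
   ('a, 'a \<times> 'a \<times> 'a, ('a \<times> 'a \<times> 'a) \<times> ('a \<times> 'a \<times> 'a) \<times> 'c) two_cat" where
  "slice L X = \<lparr>
     Cell0 = {p \<in> Cell1 L. Trg1 L p = X},
     Cell1 = slice1 L X,
     Cell2 = slice2 L X,
     Src1 = (\<lambda>(p, q, h)\<in>slice1 L X. p),
     Trg1 = (\<lambda>(p, q, h)\<in>slice1 L X. q),
     Src2 = (\<lambda>(u, v, \<theta>)\<in>slice2 L X. u),
     Trg2 = (\<lambda>(u, v, \<theta>)\<in>slice2 L X. v),
     Id1 = (\<lambda>p\<in>{p \<in> Cell1 L. Trg1 L p = X}. (p, p, Id1 L (Src1 L p))),
     Comp1 = (\<lambda>(p', q', k) (p, q, h).
       if (p, q, h) \<in> slice1 L X \<and> (p', q', k) \<in> slice1 L X \<and> p' = q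
       then (p, q', Comp1 L k h) else undefined),
     Id2 = (\<lambda>(p, q, h)\<in>slice1 L X. ((p, q, h), (p, q, h), Id2 L h)),
     VComp = (\<lambda>(u', v', \<theta>') (u, v, \<theta>).
       if (u, v, \<theta>) \<in> slice2 L X \<and> (u', v', \<theta>') \<in> slice2 L X \<and> u' = v
       then (u, v', VComp L \<theta>' \<theta>) else undefined),
     HComp = (\<lambda>((p', q', h'), (r', s', k'), \<theta>') ((p, q, h), (r, s, k), \<theta>).
       if ((p, q, h), (r, s, k), \<theta>) \<in> slice2 L X \<and>
          ((p', q', h'), (r', s', k'), \<theta>') \<in> slice2 L X \<and> p' = q
       then ((p, q', Comp1 L h' h), (r, s', Comp1 L k' k), HComp L \<theta>' \<theta>) else undefined)\<rparr>"

text \<open>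
  Equalizers and terminal objects are 2-limits: the universal properties concern both 1-cells and
  2-cells.
\<close>

definition is_equalizer :: "('o, 'a, 'c) two_cat \<Rightarrow> 'a \<Rightarrow> 'a \<Rightarrow> 'a \<Rightarrow> bool" where
  "is_equalizer K f g e \<longleftrightarrow>
     f \<in> Cell1 K \<and> g \<in> Cell1 K \<and> Src1 K f = Src1 K g \<and> Trg1 K f = Trg1 K g \<and>
     e \<in> Cell1 K \<and> Trg1 K e = Src1 K f \<and> Comp1 K f e = Comp1 K g e \<and>
     (\<forall>h\<in>Cell1 K. Trg1 K h = Src1 K f \<and> Comp1 K f h = Comp1 K g h \<longrightarrow>
        (\<exists>!u. u \<in> hom1 K (Src1 K h) (Src1 K e) \<and> Comp1 K e u = h)) \<and>
     (\<forall>u\<in>Cell1 K. \<forall>v\<in>Cell1 K. Src1 K u = Src1 K v \<and> Trg1 K u = Src1 K e \<and> Trg1 K v = Src1 K e \<longrightarrow>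
        (\<forall>\<theta>\<in>hom2 K (Comp1 K e u) (Comp1 K e v).
           HComp K (Id2 K f) \<theta> = HComp K (Id2 K g) \<theta> \<longrightarrow>
           (\<exists>!\<psi>. \<psi> \<in> hom2 K u v \<and> HComp K (Id2 K e) \<psi> = \<theta>)))"

definition is_terminal :: "('o, 'a, 'c) two_cat \<Rightarrow> 'o \<Rightarrow> bool" where
  "is_terminal K t \<longleftrightarrow> t \<in> Cell0 K \<and>
     (\<forall>x\<in>Cell0 K. (\<exists>!f. f \<in> hom1 K x t) \<and>
        (\<forall>f\<in>hom1 K x t. \<forall>g\<in>hom1 K x t. \<exists>!\<alpha>. \<alpha> \<in> hom2 K f g))"

definition has_left_2adjoint :: "('o, 'a, 'c, 'p, 'b, 'd) two_fun \<Rightarrow> bool" where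
  "has_left_2adjoint R \<longleftrightarrow>
     (\<exists>(L :: ('p, 'b, 'd, 'o, 'a, 'c) two_fun) \<eta> \<epsilon>.
        FSrc L = FTrg R \<and> FTrg L = FSrc R \<and> two_functor L \<and> two_functor R \<and>
        two_natural \<eta> \<and> NSrc \<eta> = id_fun (FTrg R) \<and> NTrg \<eta> = comp_fun R L \<and>
        two_natural \<epsilon> \<and> NSrc \<epsilon> = comp_fun L R \<and> NTrg \<epsilon> = id_fun (FSrc R) \<and>
        (\<forall>x\<in>Cell0 (FTrg R).
           Comp1 (FSrc R) (NCmp \<epsilon> (F0 L x)) (F1 L (NCmp \<eta> x)) = Id1 (FSrc R) (F0 L x)) \<and>
        (\<forall>y\<in>Cell0 (FSrc R).
           Comp1 (FTrg R) (F1 R (NCmp \<epsilon> y)) (NCmp \<eta> (F0 R y)) = Id1 (FTrg R) (F0 R y)))"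

definition bang :: "('o, 'a, 'c) two_cat \<Rightarrow> 'o \<Rightarrow> 'o \<Rightarrow> 'a" where
  "bang K t x = (THE f. f \<in> hom1 K x t)"

text \<open>For a terminal object \<open>t\<close>, the 2-functor \<open>R\<^sub>1\<close> into the slice over \<open>R t\<close>.\<close>

definition terminal_lift ::
  "('o, 'a, 'c, 'p, 'b, 'd) two_fun \<Rightarrow> 'o \<Rightarrow>
   ('o, 'a, 'c, 'b, 'b \<times> 'b \<times> 'b, ('b \<times> 'b \<times> 'b) \<times> ('b \<times> 'b \<times> 'b) \<times> 'd) two_fun" where
  "terminal_lift R t =
     (let K = FSrc R;
          R1 = (\<lambda>f. (F1 R (bang K t (Src1 K f)), F1 R (bang K t (Trg1 K f)), F1 R f))
      in \<lparr>FSrc = K, FTrg = slice (FTrg R) (F0 R t),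
          F0 = (\<lambda>x\<in>Cell0 K. F1 R (bang K t x)),
          F1 = (\<lambda>f\<in>Cell1 K. R1 f),
          F2 = (\<lambda>\<alpha>\<in>Cell2 K. (R1 (Src2 K \<alpha>), R1 (Trg2 K \<alpha>), F2 R \<alpha>))\<rparr>)"

definition parametric_right_2adjoint :: "('o, 'a, 'c, 'p, 'b, 'd) two_fun \<Rightarrow> bool" where
  "parametric_right_2adjoint R \<longleftrightarrow>
     (\<exists>t. is_terminal (FSrc R) t \<and> has_left_2adjoint (terminal_lift R t))"


section \<open>Monoidal categories\<close>

text \<open>
  \<open>x \<otimes> y\<close> is the tensor product of objects, \<open>f \<boxtimes> g\<close> that of arrows, and \<open>g \<cdot> f\<close> is composition.
\<close>

record 'v mon_cat =
  Ob :: "'v set"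
  Ar :: "'v set"
  Dom :: "'v \<Rightarrow> 'v"
  Cod :: "'v \<Rightarrow> 'v"
  Idn :: "'v \<Rightarrow> 'v"
  Cmp :: "'v \<Rightarrow> 'v \<Rightarrow> 'v" (infixl "\<cdot>\<index>" 65)
  TenO :: "'v \<Rightarrow> 'v \<Rightarrow> 'v" (infixl "\<otimes>\<index>" 75)
  TenA :: "'v \<Rightarrow> 'v \<Rightarrow> 'v" (infixl "\<boxtimes>\<index>" 75)
  Unt :: 'v ("\<I>\<index>")
  Asc :: "'v \<Rightarrow> 'v \<Rightarrow> 'v \<Rightarrow> 'v"
  Lun :: "'v \<Rightarrow> 'v"
  Run :: "'v \<Rightarrow> 'v"

definition mor :: "'v mon_cat \<Rightarrow> 'v \<Rightarrow> 'v \<Rightarrow> 'v set" where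
  "mor V x y = {f \<in> Ar V. Dom V f = x \<and> Cod V f = y}"

definition inverses :: "'v mon_cat \<Rightarrow> 'v \<Rightarrow> 'v \<Rightarrow> bool" where
  "inverses V f g \<longleftrightarrow> f \<in> Ar V \<and> g \<in> mor V (Cod V f) (Dom V f) \<and>
     g \<cdot>\<^bsub>V\<^esub> f = Idn V (Dom V f) \<and> f \<cdot>\<^bsub>V\<^esub> g = Idn V (Cod V f)"

definition invertible :: "'v mon_cat \<Rightarrow> 'v \<Rightarrow> bool" where
  "invertible V f \<longleftrightarrow> (\<exists>g. inverses V f g)"

definition inverse_of :: "'v mon_cat \<Rightarrow> 'v \<Rightarrow> 'v" where
  "inverse_of V f = (THE g. inverses V f g)"

locale monoidal_category =
  fixes V :: "'v mon_cat" (structure)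
  assumes dom: "f \<in> Ar V \<Longrightarrow> Dom V f \<in> Ob V"
    and cod: "f \<in> Ar V \<Longrightarrow> Cod V f \<in> Ob V"
    and idn: "x \<in> Ob V \<Longrightarrow> Idn V x \<in> mor V x x"
    and cmp: "f \<in> mor V x y \<Longrightarrow> g \<in> mor V y z \<Longrightarrow> g \<cdot> f \<in> mor V x z"
    and cmp_idn_right: "f \<in> mor V x y \<Longrightarrow> f \<cdot> Idn V x = f"
    and cmp_idn_left: "f \<in> mor V x y \<Longrightarrow> Idn V y \<cdot> f = f"
    and cmp_assoc:
      "f \<in> mor V w x \<Longrightarrow> g \<in> mor V x y \<Longrightarrow> h \<in> mor V y z \<Longrightarrow> h \<cdot> (g \<cdot> f) = (h \<cdot> g) \<cdot> f"
    and unt: "\<I> \<in> Ob V"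
    and ten_ob: "x \<in> Ob V \<Longrightarrow> y \<in> Ob V \<Longrightarrow> x \<otimes> y \<in> Ob V"
    and ten_ar: "f \<in> mor V x y \<Longrightarrow> g \<in> mor V x' y' \<Longrightarrow> f \<boxtimes> g \<in> mor V (x \<otimes> x') (y \<otimes> y')"
    and ten_idn: "x \<in> Ob V \<Longrightarrow> y \<in> Ob V \<Longrightarrow> Idn V x \<boxtimes> Idn V y = Idn V (x \<otimes> y)"
    and ten_cmp:
      "f \<in> mor V x y \<Longrightarrow> g \<in> mor V y z \<Longrightarrow> f' \<in> mor V x' y' \<Longrightarrow> g' \<in> mor V y' z' \<Longrightarrow>
        (g \<cdot> f) \<boxtimes> (g' \<cdot> f') = (g \<boxtimes> g') \<cdot> (f \<boxtimes> f')"
    and asc: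
      "x \<in> Ob V \<Longrightarrow> y \<in> Ob V \<Longrightarrow> z \<in> Ob V \<Longrightarrow>
        Asc V x y z \<in> mor V (x \<otimes> y \<otimes> z) (x \<otimes> (y \<otimes> z)) \<and> invertible V (Asc V x y z)"
    and lun: "x \<in> Ob V \<Longrightarrow> Lun V x \<in> mor V (\<I> \<otimes> x) x \<and> invertible V (Lun V x)"
    and run: "x \<in> Ob V \<Longrightarrow> Run V x \<in> mor V (x \<otimes> \<I>) x \<and> invertible V (Run V x)"
    and asc_natural:
      "f \<in> mor V x x' \<Longrightarrow> g \<in> mor V y y' \<Longrightarrow> h \<in> mor V z z' \<Longrightarrow>
        Asc V x' y' z' \<cdot> (f \<boxtimes> g \<boxtimes> h) = (f \<boxtimes> (g \<boxtimes> h)) \<cdot> Asc V x y z"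
    and lun_natural: "f \<in> mor V x y \<Longrightarrow> Lun V y \<cdot> (Idn V \<I> \<boxtimes> f) = f \<cdot> Lun V x"
    and run_natural: "f \<in> mor V x y \<Longrightarrow> Run V y \<cdot> (f \<boxtimes> Idn V \<I>) = f \<cdot> Run V x"
    and pentagon:
      "w \<in> Ob V \<Longrightarrow> x \<in> Ob V \<Longrightarrow> y \<in> Ob V \<Longrightarrow> z \<in> Ob V \<Longrightarrow>
        (Idn V w \<boxtimes> Asc V x y z) \<cdot> Asc V w (x \<otimes> y) z \<cdot> (Asc V w x y \<boxtimes> Idn V z) =
        Asc V w x (y \<otimes> z) \<cdot> Asc V (w \<otimes> x) y z"
    and triangle:
      "x \<in> Ob V \<Longrightarrow> y \<in> Ob V \<Longrightarrow>
        (Idn V x \<boxtimes> Lun V y) \<cdot> Asc V x \<I> y = Run V x \<boxtimes> Idn V y"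
    and ext_dom: "Dom V \<in> extensional (Ar V)"
    and ext_cod: "Cod V \<in> extensional (Ar V)"
    and ext_idn: "Idn V \<in> extensional (Ob V)"
    and ext_cmp: "\<not> (f \<in> Ar V \<and> g \<in> Ar V \<and> Dom V g = Cod V f) \<Longrightarrow> g \<cdot> f = undefined"
    and ext_ten_ob: "\<not> (x \<in> Ob V \<and> y \<in> Ob V) \<Longrightarrow> x \<otimes> y = undefined"
    and ext_ten_ar: "\<not> (f \<in> Ar V \<and> g \<in> Ar V) \<Longrightarrow> f \<boxtimes> g = undefined"
    and ext_asc: "\<not> (x \<in> Ob V \<and> y \<in> Ob V \<and> z \<in> Ob V) \<Longrightarrow> Asc V x y z = undefined"
    and ext_lun: "Lun V \<in> extensional (Ob V)"
    and ext_run: "Run V \<in> extensional (Ob V)"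

text \<open>The terminal monoidal category; its only object and its only arrow are called \<open>u\<close>.\<close>

definition unit_mon_cat :: "'v \<Rightarrow> 'v mon_cat" where
  "unit_mon_cat u = \<lparr>Ob = {u}, Ar = {u}, Dom = (\<lambda>f\<in>{u}. u), Cod = (\<lambda>f\<in>{u}. u),
     Idn = (\<lambda>x\<in>{u}. u),
     Cmp = (\<lambda>g f. if g = u \<and> f = u then u else undefined),
     TenO = (\<lambda>x y. if x = u \<and> y = u then u else undefined),
     TenA = (\<lambda>f g. if f = u \<and> g = u then u else undefined),
     Unt = u,
     Asc = (\<lambda>x y z. if x = u \<and> y = u \<and> z = u then u else undefined),
     Lun = (\<lambda>x\<in>{u}. u), Run = (\<lambda>x\<in>{u}. u)\<rparr>"

text \<open>
  The structure maps of a lax monoidal functor \<open>F\<close> are \<open>LMu F x y : F x \<otimes> F y \<rightarrow> F (x \<otimes> y)\<close> and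
  \<open>LEps F : \<I> \<rightarrow> F \<I>\<close>.
\<close>

record 'v lax_fun =
  LSrc :: "'v mon_cat"
  LTrg :: "'v mon_cat"
  LOb :: "'v \<Rightarrow> 'v"
  LAr :: "'v \<Rightarrow> 'v"
  LMu :: "'v \<Rightarrow> 'v \<Rightarrow> 'v"
  LEps :: 'v

definition lax_monoidal_functor :: "'v lax_fun \<Rightarrow> bool" where
  "lax_monoidal_functor F \<longleftrightarrow>
     (let V = LSrc F; W = LTrg F in
       monoidal_category V \<and> monoidal_category W \<and>
       LOb F \<in> Ob V \<rightarrow>\<^sub>E Ob W \<and> LAr F \<in> Ar V \<rightarrow>\<^sub>E Ar W \<and>
       (\<forall>f\<in>Ar V. LAr F f \<in> mor W (LOb F (Dom V f)) (LOb F (Cod V f))) \<and>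
       (\<forall>x\<in>Ob V. LAr F (Idn V x) = Idn W (LOb F x)) \<and>
       (\<forall>f\<in>Ar V. \<forall>g\<in>Ar V. Dom V g = Cod V f \<longrightarrow>
          LAr F (g \<cdot>\<^bsub>V\<^esub> f) = LAr F g \<cdot>\<^bsub>W\<^esub> LAr F f) \<and>
       (\<forall>x\<in>Ob V. \<forall>y\<in>Ob V.
          LMu F x y \<in> mor W (LOb F x \<otimes>\<^bsub>W\<^esub> LOb F y) (LOb F (x \<otimes>\<^bsub>V\<^esub> y))) \<and>
       (\<forall>x y. \<not> (x \<in> Ob V \<and> y \<in> Ob V) \<longrightarrow> LMu F x y = undefined) \<and>
       LEps F \<in> mor W \<I>\<^bsub>W\<^esub> (LOb F \<I>\<^bsub>V\<^esub>) \<and>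
       (\<forall>f\<in>Ar V. \<forall>g\<in>Ar V.
          LMu F (Cod V f) (Cod V g) \<cdot>\<^bsub>W\<^esub> (LAr F f \<boxtimes>\<^bsub>W\<^esub> LAr F g) =
          LAr F (f \<boxtimes>\<^bsub>V\<^esub> g) \<cdot>\<^bsub>W\<^esub> LMu F (Dom V f) (Dom V g)) \<and>
       (\<forall>x\<in>Ob V. \<forall>y\<in>Ob V. \<forall>z\<in>Ob V.
          LAr F (Asc V x y z) \<cdot>\<^bsub>W\<^esub> LMu F (x \<otimes>\<^bsub>V\<^esub> y) z \<cdot>\<^bsub>W\<^esub> (LMu F x y \<boxtimes>\<^bsub>W\<^esub> Idn W (LOb F z)) =
          LMu F x (y \<otimes>\<^bsub>V\<^esub> z) \<cdot>\<^bsub>W\<^esub> (Idn W (LOb F x) \<boxtimes>\<^bsub>W\<^esub> LMu F y z) \<cdot>\<^bsub>W\<^esub>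
            Asc W (LOb F x) (LOb F y) (LOb F z)) \<and>
       (\<forall>x\<in>Ob V.
          LAr F (Lun V x) \<cdot>\<^bsub>W\<^esub> LMu F \<I>\<^bsub>V\<^esub> x \<cdot>\<^bsub>W\<^esub> (LEps F \<boxtimes>\<^bsub>W\<^esub> Idn W (LOb F x)) =
          Lun W (LOb F x)) \<and>
       (\<forall>x\<in>Ob V.
          LAr F (Run V x) \<cdot>\<^bsub>W\<^esub> LMu F x \<I>\<^bsub>V\<^esub> \<cdot>\<^bsub>W\<^esub> (Idn W (LOb F x) \<boxtimes>\<^bsub>W\<^esub> LEps F) =
          Run W (LOb F x)))"

definition id_lax :: "'v mon_cat \<Rightarrow> 'v lax_fun" where
  "id_lax V = \<lparr>LSrc = V, LTrg = V, LOb = (\<lambda>x\<in>Ob V. x), LAr = (\<lambda>f\<in>Ar V. f),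
     LMu = (\<lambda>x y. if x \<in> Ob V \<and> y \<in> Ob V then Idn V (x \<otimes>\<^bsub>V\<^esub> y) else undefined),
     LEps = Idn V \<I>\<^bsub>V\<^esub>\<rparr>"

definition comp_lax :: "'v lax_fun \<Rightarrow> 'v lax_fun \<Rightarrow> 'v lax_fun" where
  "comp_lax G F = \<lparr>LSrc = LSrc F, LTrg = LTrg G,
     LOb = (\<lambda>x\<in>Ob (LSrc F). LOb G (LOb F x)),
     LAr = (\<lambda>f\<in>Ar (LSrc F). LAr G (LAr F f)),
     LMu = (\<lambda>x y. if x \<in> Ob (LSrc F) \<and> y \<in> Ob (LSrc F)
              then LAr G (LMu F x y) \<cdot>\<^bsub>LTrg G\<^esub> LMu G (LOb F x) (LOb F y) else undefined),
     LEps = LAr G (LEps F) \<cdot>\<^bsub>LTrg G\<^esub> LEps G\<rparr>"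

record 'v mon_nt =
  MSrc :: "'v lax_fun"
  MTrg :: "'v lax_fun"
  MCmp :: "'v \<Rightarrow> 'v"

definition monoidal_natural :: "'v mon_nt \<Rightarrow> bool" where
  "monoidal_natural \<alpha> \<longleftrightarrow>
     (let F = MSrc \<alpha>; G = MTrg \<alpha>; V = LSrc F; W = LTrg F in
       lax_monoidal_functor F \<and> lax_monoidal_functor G \<and> LSrc G = V \<and> LTrg G = W \<and>
       MCmp \<alpha> \<in> extensional (Ob V) \<and>
       (\<forall>x\<in>Ob V. MCmp \<alpha> x \<in> mor W (LOb F x) (LOb G x)) \<and>
       (\<forall>f\<in>Ar V. LAr G f \<cdot>\<^bsub>W\<^esub> MCmp \<alpha> (Dom V f) = MCmp \<alpha> (Cod V f) \<cdot>\<^bsub>W\<^esub> LAr F f) \<and>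
       (\<forall>x\<in>Ob V. \<forall>y\<in>Ob V.
          MCmp \<alpha> (x \<otimes>\<^bsub>V\<^esub> y) \<cdot>\<^bsub>W\<^esub> LMu F x y = LMu G x y \<cdot>\<^bsub>W\<^esub> (MCmp \<alpha> x \<boxtimes>\<^bsub>W\<^esub> MCmp \<alpha> y)) \<and>
       MCmp \<alpha> \<I>\<^bsub>V\<^esub> \<cdot>\<^bsub>W\<^esub> LEps F = LEps G)"

definition large_mon_cats :: "('v \<Rightarrow> 'v set) \<Rightarrow> 'v \<Rightarrow> 'v mon_cat set" where
  "large_mon_cats el U =
     {V. monoidal_category V \<and> in_universe el U (Ob V) \<and> in_universe el U (Ar V)}"

definition large_lax_funs :: "('v \<Rightarrow> 'v set) \<Rightarrow> 'v \<Rightarrow> 'v lax_fun set" where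
  "large_lax_funs el U =
     {F. lax_monoidal_functor F \<and> LSrc F \<in> large_mon_cats el U \<and> LTrg F \<in> large_mon_cats el U}"

definition large_mon_nts :: "('v \<Rightarrow> 'v set) \<Rightarrow> 'v \<Rightarrow> 'v mon_nt set" where
  "large_mon_nts el U = {\<alpha>. monoidal_natural \<alpha> \<and>
     MSrc \<alpha> \<in> large_lax_funs el U \<and> MTrg \<alpha> \<in> large_lax_funs el U}"

definition MonCAT :: "('v \<Rightarrow> 'v set) \<Rightarrow> 'v \<Rightarrow> ('v mon_cat, 'v lax_fun, 'v mon_nt) two_cat" where
  "MonCAT el U = \<lparr>
     Cell0 = large_mon_cats el U,
     Cell1 = large_lax_funs el U,
     Cell2 = large_mon_nts el U,
     Src1 = (\<lambda>F\<in>large_lax_funs el U. LSrc F),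
     Trg1 = (\<lambda>F\<in>large_lax_funs el U. LTrg F),
     Src2 = (\<lambda>\<alpha>\<in>large_mon_nts el U. MSrc \<alpha>),
     Trg2 = (\<lambda>\<alpha>\<in>large_mon_nts el U. MTrg \<alpha>),
     Id1 = (\<lambda>V\<in>large_mon_cats el U. id_lax V),
     Comp1 = (\<lambda>G F.
       if F \<in> large_lax_funs el U \<and> G \<in> large_lax_funs el U \<and> LSrc G = LTrg F
       then comp_lax G F else undefined),
     Id2 = (\<lambda>F\<in>large_lax_funs el U.
       \<lparr>MSrc = F, MTrg = F, MCmp = (\<lambda>x\<in>Ob (LSrc F). Idn (LTrg F) (LOb F x))\<rparr>),
     VComp = (\<lambda>\<beta> \<alpha>.
       if \<alpha> \<in> large_mon_nts el U \<and> \<beta> \<in> large_mon_nts el U \<and> MSrc \<beta> = MTrg \<alpha>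
       then \<lparr>MSrc = MSrc \<alpha>, MTrg = MTrg \<beta>,
              MCmp = (\<lambda>x\<in>Ob (LSrc (MSrc \<alpha>)). MCmp \<beta> x \<cdot>\<^bsub>LTrg (MSrc \<alpha>)\<^esub> MCmp \<alpha> x)\<rparr>
       else undefined),
     HComp = (\<lambda>\<beta> \<alpha>.
       if \<alpha> \<in> large_mon_nts el U \<and> \<beta> \<in> large_mon_nts el U \<and> LSrc (MSrc \<beta>) = LTrg (MSrc \<alpha>)
       then \<lparr>MSrc = comp_lax (MSrc \<beta>) (MSrc \<alpha>), MTrg = comp_lax (MTrg \<beta>) (MTrg \<alpha>),
              MCmp = (\<lambda>x\<in>Ob (LSrc (MSrc \<alpha>)).
                MCmp \<beta> (LOb (MTrg \<alpha>) x) \<cdot>\<^bsub>LTrg (MSrc \<beta>)\<^esub> LAr (MSrc \<beta>) (MCmp \<alpha> x))\<rparr>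
       else undefined)\<rparr>"


section \<open>Enriched categories\<close>

text \<open>
  For a \<open>\<V>\<close>-category \<open>X\<close>, composition is \<open>VCmp X a b c : X(b,c) \<otimes> X(a,b) \<rightarrow> X(a,c)\<close> and the
  identities are \<open>VIdn X a : \<I> \<rightarrow> X(a,a)\<close>. The base \<open>\<V>\<close> is not part of the record.
\<close>

record 'v v_cat =
  VOb :: "'v set"
  VHom :: "'v \<Rightarrow> 'v \<Rightarrow> 'v"
  VCmp :: "'v \<Rightarrow> 'v \<Rightarrow> 'v \<Rightarrow> 'v"
  VIdn :: "'v \<Rightarrow> 'v"

record 'v v_fun =
  VSrc :: "'v v_cat"
  VTrg :: "'v v_cat"
  VFOb :: "'v \<Rightarrow> 'v"
  VFHom :: "'v \<Rightarrow> 'v \<Rightarrow> 'v"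

record 'v v_nt =
  VNSrc :: "'v v_fun"
  VNTrg :: "'v v_fun"
  VNCmp :: "'v \<Rightarrow> 'v"

definition enriched_category :: "'v mon_cat \<Rightarrow> 'v v_cat \<Rightarrow> bool" where
  "enriched_category V X \<longleftrightarrow>
     (\<forall>a\<in>VOb X. \<forall>b\<in>VOb X. VHom X a b \<in> Ob V) \<and>
     (\<forall>a b. \<not> (a \<in> VOb X \<and> b \<in> VOb X) \<longrightarrow> VHom X a b = undefined) \<and>
     (\<forall>a\<in>VOb X. \<forall>b\<in>VOb X. \<forall>c\<in>VOb X.
        VCmp X a b c \<in> mor V (VHom X b c \<otimes>\<^bsub>V\<^esub> VHom X a b) (VHom X a c)) \<and>
     (\<forall>a b c. \<not> (a \<in> VOb X \<and> b \<in> VOb X \<and> c \<in> VOb X) \<longrightarrow> VCmp X a b c = undefined) \<and>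
     (\<forall>a\<in>VOb X. VIdn X a \<in> mor V \<I>\<^bsub>V\<^esub> (VHom X a a)) \<and>
     VIdn X \<in> extensional (VOb X) \<and>
     (\<forall>a\<in>VOb X. \<forall>b\<in>VOb X. \<forall>c\<in>VOb X. \<forall>d\<in>VOb X.
        VCmp X a b d \<cdot>\<^bsub>V\<^esub> (VCmp X b c d \<boxtimes>\<^bsub>V\<^esub> Idn V (VHom X a b)) =
        VCmp X a c d \<cdot>\<^bsub>V\<^esub> (Idn V (VHom X c d) \<boxtimes>\<^bsub>V\<^esub> VCmp X a b c) \<cdot>\<^bsub>V\<^esub>
          Asc V (VHom X c d) (VHom X b c) (VHom X a b)) \<and>
     (\<forall>a\<in>VOb X. \<forall>b\<in>VOb X.
        VCmp X a b b \<cdot>\<^bsub>V\<^esub> (VIdn X b \<boxtimes>\<^bsub>V\<^esub> Idn V (VHom X a b)) = Lun V (VHom X a b)) \<and>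
     (\<forall>a\<in>VOb X. \<forall>b\<in>VOb X.
        VCmp X a a b \<cdot>\<^bsub>V\<^esub> (Idn V (VHom X a b) \<boxtimes>\<^bsub>V\<^esub> VIdn X a) = Run V (VHom X a b))"

definition enriched_functor :: "'v mon_cat \<Rightarrow> 'v v_fun \<Rightarrow> bool" where
  "enriched_functor V S \<longleftrightarrow>
     (let X = VSrc S; Y = VTrg S; s = VFOb S in
       enriched_category V X \<and> enriched_category V Y \<and>
       s \<in> VOb X \<rightarrow>\<^sub>E VOb Y \<and>
       (\<forall>a\<in>VOb X. \<forall>b\<in>VOb X. VFHom S a b \<in> mor V (VHom X a b) (VHom Y (s a) (s b))) \<and>
       (\<forall>a b. \<not> (a \<in> VOb X \<and> b \<in> VOb X) \<longrightarrow> VFHom S a b = undefined) \<and>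
       (\<forall>a\<in>VOb X. \<forall>b\<in>VOb X. \<forall>c\<in>VOb X.
          VFHom S a c \<cdot>\<^bsub>V\<^esub> VCmp X a b c =
          VCmp Y (s a) (s b) (s c) \<cdot>\<^bsub>V\<^esub> (VFHom S b c \<boxtimes>\<^bsub>V\<^esub> VFHom S a b)) \<and>
       (\<forall>a\<in>VOb X. VFHom S a a \<cdot>\<^bsub>V\<^esub> VIdn X a = VIdn Y (s a)))"

definition enriched_natural :: "'v mon_cat \<Rightarrow> 'v v_nt \<Rightarrow> bool" where
  "enriched_natural V \<tau> \<longleftrightarrow>
     (let S = VNSrc \<tau>; T = VNTrg \<tau>; X = VSrc S; Y = VTrg S; s = VFOb S; t = VFOb T in
       enriched_functor V S \<and> enriched_functor V T \<and> VSrc T = X \<and> VTrg T = Y \<and>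
       VNCmp \<tau> \<in> extensional (VOb X) \<and>
       (\<forall>a\<in>VOb X. VNCmp \<tau> a \<in> mor V \<I>\<^bsub>V\<^esub> (VHom Y (s a) (t a))) \<and>
       (\<forall>a\<in>VOb X. \<forall>b\<in>VOb X.
          VCmp Y (s a) (s b) (t b) \<cdot>\<^bsub>V\<^esub> (VNCmp \<tau> b \<boxtimes>\<^bsub>V\<^esub> VFHom S a b) \<cdot>\<^bsub>V\<^esub>
            inverse_of V (Lun V (VHom X a b)) =
          VCmp Y (s a) (t a) (t b) \<cdot>\<^bsub>V\<^esub> (VFHom T a b \<boxtimes>\<^bsub>V\<^esub> VNCmp \<tau> a) \<cdot>\<^bsub>V\<^esub>
            inverse_of V (Run V (VHom X a b))))"

definition small_v_cats :: "('v \<Rightarrow> 'v set) \<Rightarrow> 'v \<Rightarrow> 'v mon_cat \<Rightarrow> 'v v_cat set" where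
  "small_v_cats el U V = {X. enriched_category V X \<and> in_universe el U (VOb X)}"

definition small_v_funs :: "('v \<Rightarrow> 'v set) \<Rightarrow> 'v \<Rightarrow> 'v mon_cat \<Rightarrow> 'v v_fun set" where
  "small_v_funs el U V =
     {S. enriched_functor V S \<and> VSrc S \<in> small_v_cats el U V \<and> VTrg S \<in> small_v_cats el U V}"

definition small_v_nts :: "('v \<Rightarrow> 'v set) \<Rightarrow> 'v \<Rightarrow> 'v mon_cat \<Rightarrow> 'v v_nt set" where
  "small_v_nts el U V = {\<tau>. enriched_natural V \<tau> \<and>
     VNSrc \<tau> \<in> small_v_funs el U V \<and> VNTrg \<tau> \<in> small_v_funs el U V}"

definition v_id_fun :: "'v mon_cat \<Rightarrow> 'v v_cat \<Rightarrow> 'v v_fun" where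
  "v_id_fun V X = \<lparr>VSrc = X, VTrg = X, VFOb = (\<lambda>a\<in>VOb X. a),
     VFHom = (\<lambda>a b. if a \<in> VOb X \<and> b \<in> VOb X then Idn V (VHom X a b) else undefined)\<rparr>"

definition v_comp_fun :: "'v mon_cat \<Rightarrow> 'v v_fun \<Rightarrow> 'v v_fun \<Rightarrow> 'v v_fun" where
  "v_comp_fun V T S = \<lparr>VSrc = VSrc S, VTrg = VTrg T,
     VFOb = (\<lambda>a\<in>VOb (VSrc S). VFOb T (VFOb S a)),
     VFHom = (\<lambda>a b. if a \<in> VOb (VSrc S) \<and> b \<in> VOb (VSrc S)
                then VFHom T (VFOb S a) (VFOb S b) \<cdot>\<^bsub>V\<^esub> VFHom S a b else undefined)\<rparr>"

text \<open>
  The composite of two elements \<open>x : \<I> \<rightarrow> Y(a,b)\<close> and \<open>y : \<I> \<rightarrow> Y(b,c)\<close> in the underlying category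
  of \<open>Y\<close>.
\<close>

definition v_comp_elem :: "'v mon_cat \<Rightarrow> 'v v_cat \<Rightarrow> 'v \<Rightarrow> 'v \<Rightarrow> 'v \<Rightarrow> 'v \<Rightarrow> 'v \<Rightarrow> 'v" where
  "v_comp_elem V Y a b c y x =
     VCmp Y a b c \<cdot>\<^bsub>V\<^esub> (y \<boxtimes>\<^bsub>V\<^esub> x) \<cdot>\<^bsub>V\<^esub> inverse_of V (Lun V \<I>\<^bsub>V\<^esub>)"

definition VCat ::
  "('v \<Rightarrow> 'v set) \<Rightarrow> 'v \<Rightarrow> 'v mon_cat \<Rightarrow> ('v v_cat, 'v v_fun, 'v v_nt) two_cat" where
  "VCat el U V = \<lparr>
     Cell0 = small_v_cats el U V,
     Cell1 = small_v_funs el U V,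
     Cell2 = small_v_nts el U V,
     Src1 = (\<lambda>S\<in>small_v_funs el U V. VSrc S),
     Trg1 = (\<lambda>S\<in>small_v_funs el U V. VTrg S),
     Src2 = (\<lambda>\<tau>\<in>small_v_nts el U V. VNSrc \<tau>),
     Trg2 = (\<lambda>\<tau>\<in>small_v_nts el U V. VNTrg \<tau>),
     Id1 = (\<lambda>X\<in>small_v_cats el U V. v_id_fun V X),
     Comp1 = (\<lambda>T S.
       if S \<in> small_v_funs el U V \<and> T \<in> small_v_funs el U V \<and> VSrc T = VTrg S
       then v_comp_fun V T S else undefined),
     Id2 = (\<lambda>S\<in>small_v_funs el U V.
       \<lparr>VNSrc = S, VNTrg = S, VNCmp = (\<lambda>a\<in>VOb (VSrc S). VIdn (VTrg S) (VFOb S a))\<rparr>),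
     VComp = (\<lambda>\<tau> \<sigma>.
       if \<sigma> \<in> small_v_nts el U V \<and> \<tau> \<in> small_v_nts el U V \<and> VNSrc \<tau> = VNTrg \<sigma>
       then \<lparr>VNSrc = VNSrc \<sigma>, VNTrg = VNTrg \<tau>,
              VNCmp = (\<lambda>a\<in>VOb (VSrc (VNSrc \<sigma>)).
                v_comp_elem V (VTrg (VNSrc \<sigma>))
                  (VFOb (VNSrc \<sigma>) a) (VFOb (VNTrg \<sigma>) a) (VFOb (VNTrg \<tau>) a)
                  (VNCmp \<tau> a) (VNCmp \<sigma> a))\<rparr>
       else undefined),
     HComp = (\<lambda>\<tau> \<sigma>.
       if \<sigma> \<in> small_v_nts el U V \<and> \<tau> \<in> small_v_nts el U V \<and> VSrc (VNSrc \<tau>) = VTrg (VNSrc \<sigma>)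
       then \<lparr>VNSrc = v_comp_fun V (VNSrc \<tau>) (VNSrc \<sigma>),
              VNTrg = v_comp_fun V (VNTrg \<tau>) (VNTrg \<sigma>),
              VNCmp = (\<lambda>a\<in>VOb (VSrc (VNSrc \<sigma>)).
                let s = VFOb (VNSrc \<sigma>) a; s' = VFOb (VNTrg \<sigma>) a;
                    T = VNSrc \<tau>; T' = VNTrg \<tau>
                in v_comp_elem V (VTrg T) (VFOb T s) (VFOb T s') (VFOb T' s')
                     (VNCmp \<tau> s') (VFHom T s s' \<cdot>\<^bsub>V\<^esub> VNCmp \<sigma> a))\<rparr>
       else undefined)\<rparr>"


text \<open>
  \<open>Enr(1)\<close> is \<open>Set\<^sub>l\<^sub>c\<close>: passing to underlying sets of objects is bijective on 0-cells (onto the small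
  sets) and on 1-cells (onto the functions), and any two parallel 1-cells are related by exactly one
  2-cell (\<open>VCat_unit_cell0\<close>, \<open>VCat_unit_cell1\<close>, \<open>VCat_unit_cell2\<close>).
\<close>

definition indiscrete :: "'v \<Rightarrow> 'v set \<Rightarrow> 'v v_cat" where
  "indiscrete u A = \<lparr>VOb = A, VHom = (\<lambda>a b. if a \<in> A \<and> b \<in> A then u else undefined),
     VCmp = (\<lambda>a b c. if a \<in> A \<and> b \<in> A \<and> c \<in> A then u else undefined), VIdn = (\<lambda>a\<in>A. u)\<rparr>"

lemma unit_mor [simp]: "mor (unit_mon_cat u) x y = (if x = u \<and> y = u then {u} else {})"
  by (auto simp: mor_def unit_mon_cat_def)

lemma unit_sel [simp]:
  "Ob (unit_mon_cat u) = {u}" "Unt (unit_mon_cat u) = u" "Idn (unit_mon_cat u) u = u"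
  "u \<cdot>\<^bsub>unit_mon_cat u\<^esub> u = u" "u \<otimes>\<^bsub>unit_mon_cat u\<^esub> u = u" "u \<boxtimes>\<^bsub>unit_mon_cat u\<^esub> u = u"
  "Asc (unit_mon_cat u) u u u = u" "Lun (unit_mon_cat u) u = u" "Run (unit_mon_cat u) u = u"
  "Ar (unit_mon_cat u) = {u}"  "Dom (unit_mon_cat u) u = u" "Cod (unit_mon_cat u) u = u"
  by (simp_all add: unit_mon_cat_def)

lemma unit_inverse [simp]: "inverse_of (unit_mon_cat u) u = u"
  by (auto simp: inverse_of_def inverses_def intro!: the_equality)

lemma enriched_category_unit_iff:
  "enriched_category (unit_mon_cat u) X \<longleftrightarrow> X = indiscrete u (VOb X)"
proof
  assume X: "enriched_category (unit_mon_cat u) X"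
  then have h: "VHom X = (\<lambda>a b. if a \<in> VOb X \<and> b \<in> VOb X then u else undefined)"
    by (auto simp: enriched_category_def fun_eq_iff)
  have c: "VCmp X = (\<lambda>a b c. if a \<in> VOb X \<and> b \<in> VOb X \<and> c \<in> VOb X then u else undefined)"
    using X by (auto simp: enriched_category_def fun_eq_iff h)
  have i: "VIdn X = (\<lambda>a\<in>VOb X. u)"
    using X by (auto simp: enriched_category_def fun_eq_iff h extensional_def restrict_def)
  show "X = indiscrete u (VOb X)"
    by (rule v_cat.equality) (simp_all add: indiscrete_def c h i)
next
  assume X: "X = indiscrete u (VOb X)"
  have *: "VHom X = (\<lambda>a b. if a \<in> VOb X \<and> b \<in> VOb X then u else undefined)"
    "VCmp X = (\<lambda>a b c. if a \<in> VOb X \<and> b \<in> VOb X \<and> c \<in> VOb X then u else undefined)"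
    "VIdn X = (\<lambda>a\<in>VOb X. u)"
    by (subst X, simp add: indiscrete_def)+
  show "enriched_category (unit_mon_cat u) X"
    unfolding enriched_category_def * by auto
qed

lemma VCat_unit_cell0:
  "bij_betw VOb (Cell0 (VCat el U (unit_mon_cat u))) {A. in_universe el U A}"
  by (rule bij_betw_byWitness[where f' = "indiscrete u"])
     (auto simp: VCat_def small_v_cats_def enriched_category_unit_iff indiscrete_def)

lemma unit_hom:
  "enriched_category (unit_mon_cat u) X \<Longrightarrow> a \<in> VOb X \<Longrightarrow> b \<in> VOb X \<Longrightarrow> VHom X a b = u"
  "enriched_category (unit_mon_cat u) X \<Longrightarrow> a \<in> VOb X \<Longrightarrow> b \<in> VOb X \<Longrightarrow> c \<in> VOb X \<Longrightarrow> VCmp X a b c = u"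
  "enriched_category (unit_mon_cat u) X \<Longrightarrow> a \<in> VOb X \<Longrightarrow> VIdn X a = u"
proof -
  assume "enriched_category (unit_mon_cat u) X"
  then have X: "X = indiscrete u (VOb X)" by (simp only: enriched_category_unit_iff)
  show "a \<in> VOb X \<Longrightarrow> b \<in> VOb X \<Longrightarrow> VHom X a b = u"
    by (subst X) (simp add: indiscrete_def)
  show "a \<in> VOb X \<Longrightarrow> b \<in> VOb X \<Longrightarrow> c \<in> VOb X \<Longrightarrow> VCmp X a b c = u"
    by (subst X) (simp add: indiscrete_def)
  show "a \<in> VOb X \<Longrightarrow> VIdn X a = u"
    by (subst X) (simp add: indiscrete_def)
qed

lemma enriched_functor_unit_iff:
  "enriched_functor (unit_mon_cat u) S \<longleftrightarrow>
     enriched_category (unit_mon_cat u) (VSrc S) \<and> enriched_category (unit_mon_cat u) (VTrg S) \<and>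
     VFOb S \<in> VOb (VSrc S) \<rightarrow>\<^sub>E VOb (VTrg S) \<and>
     VFHom S = (\<lambda>a b. if a \<in> VOb (VSrc S) \<and> b \<in> VOb (VSrc S) then u else undefined)"
proof (cases "enriched_category (unit_mon_cat u) (VSrc S) \<and> enriched_category (unit_mon_cat u) (VTrg S) \<and>
     VFOb S \<in> VOb (VSrc S) \<rightarrow>\<^sub>E VOb (VTrg S)")
  case True
  then have *: "a \<in> VOb (VSrc S) \<Longrightarrow> VFOb S a \<in> VOb (VTrg S)" for a by auto
  show ?thesis using True by (auto simp: enriched_functor_def Let_def unit_hom * fun_eq_iff)
qed (auto simp: enriched_functor_def Let_def)

lemma VCat_unit_cell1:
  assumes "X \<in> Cell0 (VCat el U (unit_mon_cat u))" "Y \<in> Cell0 (VCat el U (unit_mon_cat u))"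
  shows "bij_betw VFOb (hom1 (VCat el U (unit_mon_cat u)) X Y) (VOb X \<rightarrow>\<^sub>E VOb Y)"
  using assms
  by (intro bij_betw_byWitness[where f' = "\<lambda>s. \<lparr>VSrc = X, VTrg = Y, VFOb = s,
        VFHom = (\<lambda>a b. if a \<in> VOb X \<and> b \<in> VOb X then u else undefined)\<rparr>"])
     (auto simp: VCat_def hom1_def small_v_funs_def small_v_cats_def enriched_functor_unit_iff)

lemma VCat_unit_cell2:
  assumes "S \<in> hom1 (VCat el U (unit_mon_cat u)) X Y" "T \<in> hom1 (VCat el U (unit_mon_cat u)) X Y"
  shows "\<exists>!\<tau>. \<tau> \<in> hom2 (VCat el U (unit_mon_cat u)) S T"
proof -
  have S: "S \<in> small_v_funs el U (unit_mon_cat u)" "VSrc S = X" "VTrg S = Y"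
    and T: "T \<in> small_v_funs el U (unit_mon_cat u)" "VSrc T = X" "VTrg T = Y"
    using assms by (auto simp: hom1_def VCat_def)
  have XY: "enriched_category (unit_mon_cat u) X" "enriched_category (unit_mon_cat u) Y"
    "\<And>a. a \<in> VOb X \<Longrightarrow> VFOb S a \<in> VOb Y" "\<And>a. a \<in> VOb X \<Longrightarrow> VFOb T a \<in> VOb Y"
    using S T by (auto simp: small_v_funs_def small_v_cats_def enriched_functor_unit_iff)
  have SE: "enriched_functor (unit_mon_cat u) S" "enriched_functor (unit_mon_cat u) T"
    using S T by (auto simp: small_v_funs_def)
  then have fh: "\<And>a b. a \<in> VOb X \<Longrightarrow> b \<in> VOb X \<Longrightarrow> VFHom S a b = u"
     "\<And>a b. a \<in> VOb X \<Longrightarrow> b \<in> VOb X \<Longrightarrow> VFHom T a b = u"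
    using S T by (auto simp: enriched_functor_unit_iff)
  let ?\<tau> = "\<lparr>VNSrc = S, VNTrg = T, VNCmp = (\<lambda>a\<in>VOb X. u)\<rparr>"
  have nat: "enriched_natural (unit_mon_cat u) ?\<tau>"
    unfolding enriched_natural_def Let_def v_nt.select_convs S T
    by (auto simp: SE unit_hom(1)[OF XY(1)] unit_hom[OF XY(2)] XY(3,4) fh)
  show ?thesis
  proof (rule ex1I)
    show "?\<tau> \<in> hom2 (VCat el U (unit_mon_cat u)) S T"
      using nat S(1) T(1) by (simp add: hom2_def VCat_def small_v_nts_def)
  next
    fix \<tau> assume "\<tau> \<in> hom2 (VCat el U (unit_mon_cat u)) S T"
    then have t: "VNSrc \<tau> = S" "VNTrg \<tau> = T" "enriched_natural (unit_mon_cat u) \<tau>"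
      by (auto simp: hom2_def VCat_def small_v_nts_def)
    have "VNCmp \<tau> a = (\<lambda>a\<in>VOb X. u) a" for a
      using t(3) unfolding enriched_natural_def Let_def t(1,2) S T
      by (cases "a \<in> VOb X") (auto simp: unit_hom[OF XY(2)] XY(3,4) extensional_def)
    then show "\<tau> = ?\<tau>" using t(1,2) by (cases \<tau>) auto
  qed
qed


section \<open>The 2-functor Enr\<close>

definition base_cat :: "'v lax_fun \<Rightarrow> 'v v_cat \<Rightarrow> 'v v_cat" where
  "base_cat F X = \<lparr>VOb = VOb X,
     VHom = (\<lambda>a b. if a \<in> VOb X \<and> b \<in> VOb X then LOb F (VHom X a b) else undefined),
     VCmp = (\<lambda>a b c. if a \<in> VOb X \<and> b \<in> VOb X \<and> c \<in> VOb X
               then LAr F (VCmp X a b c) \<cdot>\<^bsub>LTrg F\<^esub> LMu F (VHom X b c) (VHom X a b)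
               else undefined),
     VIdn = (\<lambda>a\<in>VOb X. LAr F (VIdn X a) \<cdot>\<^bsub>LTrg F\<^esub> LEps F)\<rparr>"

definition base_fun :: "'v lax_fun \<Rightarrow> 'v v_fun \<Rightarrow> 'v v_fun" where
  "base_fun F S = \<lparr>VSrc = base_cat F (VSrc S), VTrg = base_cat F (VTrg S), VFOb = VFOb S,
     VFHom = (\<lambda>a b. if a \<in> VOb (VSrc S) \<and> b \<in> VOb (VSrc S)
                then LAr F (VFHom S a b) else undefined)\<rparr>"

definition base_nt :: "'v lax_fun \<Rightarrow> 'v v_nt \<Rightarrow> 'v v_nt" where
  "base_nt F \<tau> = \<lparr>VNSrc = base_fun F (VNSrc \<tau>), VNTrg = base_fun F (VNTrg \<tau>),
     VNCmp = (\<lambda>a\<in>VOb (VSrc (VNSrc \<tau>)). LAr F (VNCmp \<tau> a) \<cdot>\<^bsub>LTrg F\<^esub> LEps F)\<rparr>"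

definition base_change ::
  "('v \<Rightarrow> 'v set) \<Rightarrow> 'v \<Rightarrow> 'v lax_fun \<Rightarrow>
   ('v v_cat, 'v v_fun, 'v v_nt, 'v v_cat, 'v v_fun, 'v v_nt) two_fun" where
  "base_change el U F = \<lparr>FSrc = VCat el U (LSrc F), FTrg = VCat el U (LTrg F),
     F0 = (\<lambda>X\<in>small_v_cats el U (LSrc F). base_cat F X),
     F1 = (\<lambda>S\<in>small_v_funs el U (LSrc F). base_fun F S),
     F2 = (\<lambda>\<tau>\<in>small_v_nts el U (LSrc F). base_nt F \<tau>)\<rparr>"

text \<open>
  A monoidal natural transformation \<open>\<alpha>\<close> from \<open>F\<close> to \<open>G\<close> induces the 2-natural transformation whose
  component at \<open>X\<close> is the identity on objects and has the components of \<open>\<alpha>\<close> on hom-objects.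
\<close>

definition base_change_nt ::
  "('v \<Rightarrow> 'v set) \<Rightarrow> 'v \<Rightarrow> 'v mon_nt \<Rightarrow>
   ('v v_cat, 'v v_fun, 'v v_nt, 'v v_cat, 'v v_fun, 'v v_nt) two_nt" where
  "base_change_nt el U \<alpha> = \<lparr>NSrc = base_change el U (MSrc \<alpha>), NTrg = base_change el U (MTrg \<alpha>),
     NCmp = (\<lambda>X\<in>small_v_cats el U (LSrc (MSrc \<alpha>)).
       \<lparr>VSrc = base_cat (MSrc \<alpha>) X, VTrg = base_cat (MTrg \<alpha>) X, VFOb = (\<lambda>a\<in>VOb X. a),
        VFHom = (\<lambda>a b. if a \<in> VOb X \<and> b \<in> VOb X then MCmp \<alpha> (VHom X a b) else undefined)\<rparr>)\<rparr>"

definition Enr ::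
  "('v \<Rightarrow> 'v set) \<Rightarrow> 'v \<Rightarrow> 'v \<Rightarrow>
   ('v mon_cat, 'v lax_fun, 'v mon_nt,
    ('v v_cat, 'v v_fun, 'v v_nt) two_cat,
    ('v v_cat, 'v v_fun, 'v v_nt, 'v v_cat, 'v v_fun, 'v v_nt) two_fun,
    ('v v_cat, 'v v_fun, 'v v_nt, 'v v_cat, 'v v_fun, 'v v_nt) two_nt) two_fun" where
  "Enr el U1 U2 = \<lparr>FSrc = MonCAT el U2, FTrg = TwoCAT el U2,
     F0 = (\<lambda>V\<in>large_mon_cats el U2. VCat el U1 V),
     F1 = (\<lambda>F\<in>large_lax_funs el U2. base_change el U1 F),
     F2 = (\<lambda>\<alpha>\<in>large_mon_nts el U2. base_change_nt el U1 \<alpha>)\<rparr>"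

text \<open>Any singleton in \<open>U2\<close> carries the terminal monoidal category; \<open>U1\<close> serves as its element.\<close>

abbreviation Enr1 where
  "Enr1 el U1 U2 \<equiv> terminal_lift (Enr el U1 U2) (unit_mon_cat U1)"

end

theory Submission
  imports Defs "HOL-Library.Countable"
begin

text \<open>
  A monoidal category \<open>\<U>\<close> mapping to \<open>\<V>\<close> is closed under \<open>\<otimes>\<close>, so with an object sent to \<open>x\<close> it has one
  receiving a map from \<open>x \<otimes> x\<close>. A \<open>\<V>\<close>-category is less demanding: it multiplies only hom-objects
  of composable pairs, so \<open>X(a,b) \<otimes> X(a,b)\<close> need not map to any hom-object when \<open>a\<close> and \<open>b\<close>
  differ. The counterexample exploits this gap.

  Let \<open>\<V>\<close> be the discrete monoidal category on the additive group of integers, and let \<open>\<W>\<close> be the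
  chaotic one, with exactly one arrow between any two integers. Every function from integers to
  integers is a lax monoidal functor from \<open>\<V>\<close> to \<open>\<W>\<close>. Take the constant function 0 and a function
  that vanishes precisely on \<open>S = {-1, 0, 1}\<close>. If a lax monoidal functor \<open>h\<close> into \<open>\<V>\<close> equalizes the
  two, then it takes values in \<open>S\<close>, and the arrow \<open>h x + h x \<rightarrow> h (x \<otimes> x)\<close> of the discrete \<open>\<V>\<close>
  shows that twice a value of \<open>h\<close> lies in \<open>S\<close>. Hence \<open>h\<close> is constantly 0, and the equalizer is the
  inclusion of the terminal monoidal category \<open>{0}\<close> (\<open>incl_is_equalizer\<close>). But the \<open>\<V>\<close>-category with
  two objects and \<open>X(a,b) = 1\<close>, \<open>X(b,a) = -1\<close>, \<open>X(a,a) = X(b,b) = 0\<close> has all its hom-objects in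
  \<open>S\<close>. So base change along the two functors agrees on it, although it does not come from an
  \<open>{0}\<close>-category. The 2-functor from the point that names it is equalized by the images of the two
  functors in the slice and does not factor through the image of the inclusion
  (\<open>Enr1_no_factorization\<close>).

  For the second claim, a right 2-adjoint carries equalizers to diagrams through which every
  equalized 1-cell factors: transpose, factor, and transpose back (\<open>right_2adjoint_factorization\<close>).

  Both claims are refutations, and what is refuted asserts that the images of the three functors
  are 1-cells of the slice. These assertions supply the 2-category structure on the enriched
  categories and the 2-functoriality of base change.
\<close>

section \<open>Thin strict monoidal categories\<close>

lemma lax_functor_ob: "lax_monoidal_functor F \<Longrightarrow> x \<in> Ob (LSrc F) \<Longrightarrow> LOb F x \<in> Ob (LTrg F)"
  by (auto simp: lax_monoidal_functor_def Let_def)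

text \<open>
  A preorder \<open>R\<close> on a submonoid \<open>M\<close>, compatible with addition, is a strict monoidal category with at
  most one arrow \<open>i \<rightarrow> j\<close>. Objects and arrows have to be elements of the ambient universe, whence the
  encodings \<open>c\<close> of monoid elements and \<open>p\<close> of pairs. The discrete and the chaotic monoidal category
  and the terminal one are all of this form.
\<close>

locale thin_monoidal =
  fixes c :: "'m::monoid_add \<Rightarrow> 'v" and p :: "'m \<times> 'm \<Rightarrow> 'v"
    and M :: "'m set" and R :: "'m \<Rightarrow> 'm \<Rightarrow> bool"
  assumes inj_c: "inj c" and inj_p: "inj p"
    and zero_closed: "0 \<in> M" and add_closed: "i \<in> M \<Longrightarrow> j \<in> M \<Longrightarrow> i + j \<in> M"
    and refl: "i \<in> M \<Longrightarrow> R i i"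
    and trans: "R i j \<Longrightarrow> R j k \<Longrightarrow> R i k"
    and add_mono: "R i j \<Longrightarrow> R k l \<Longrightarrow> R (i + k) (j + l)"
begin

definition arrow :: "'v \<Rightarrow> bool" where
  "arrow f \<longleftrightarrow> (\<exists>i\<in>M. \<exists>j\<in>M. R i j \<and> f = p (i, j))"

definition T :: "'v mon_cat" where
  "T = \<lparr>Ob = c ` M, Ar = Collect arrow,
     Dom = (\<lambda>f\<in>Collect arrow. c (fst (inv p f))), Cod = (\<lambda>f\<in>Collect arrow. c (snd (inv p f))),
     Idn = (\<lambda>x\<in>c ` M. p (inv c x, inv c x)),
     Cmp = (\<lambda>g f. if arrow f \<and> arrow g \<and> fst (inv p g) = snd (inv p f)
              then p (fst (inv p f), snd (inv p g)) else undefined),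
     TenO = (\<lambda>x y. if x \<in> c ` M \<and> y \<in> c ` M then c (inv c x + inv c y) else undefined),
     TenA = (\<lambda>f g. if arrow f \<and> arrow g
               then p (fst (inv p f) + fst (inv p g), snd (inv p f) + snd (inv p g)) else undefined),
     Unt = c 0,
     Asc = (\<lambda>x y z. if x \<in> c ` M \<and> y \<in> c ` M \<and> z \<in> c ` M
              then p (inv c x + inv c y + inv c z, inv c x + inv c y + inv c z) else undefined),
     Lun = (\<lambda>x\<in>c ` M. p (inv c x, inv c x)), Run = (\<lambda>x\<in>c ` M. p (inv c x, inv c x))\<rparr>"

lemma inv_c [simp]: "inv c (c i) = i"
  using inj_c by simp

lemma inv_p [simp]: "inv p (p i) = i"
  using inj_p by simp

lemma c_eq [simp]: "c i = c j \<longleftrightarrow> i = j"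
  using inj_c by (simp add: inj_eq)

lemma p_eq [simp]: "p i = p j \<longleftrightarrow> i = j"
  using inj_p by (simp add: inj_eq)

lemma c_mem [simp]: "c i \<in> c ` M \<longleftrightarrow> i \<in> M"
  by auto

lemma arrow_p [simp]: "arrow (p (i, j)) \<longleftrightarrow> i \<in> M \<and> j \<in> M \<and> R i j"
  by (auto simp: arrow_def)

lemmas closed = zero_closed add_closed refl add_mono

lemma T_sel [simp]:
  "Ob T = c ` M" "f \<in> Ar T \<longleftrightarrow> arrow f" "Unt T = c 0"
  "i \<in> M \<Longrightarrow> j \<in> M \<Longrightarrow> R i j \<Longrightarrow> Dom T (p (i, j)) = c i"
  "i \<in> M \<Longrightarrow> j \<in> M \<Longrightarrow> R i j \<Longrightarrow> Cod T (p (i, j)) = c j"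
  "i \<in> M \<Longrightarrow> Idn T (c i) = p (i, i)"
  "i \<in> M \<Longrightarrow> j \<in> M \<Longrightarrow> k \<in> M \<Longrightarrow> R i j \<Longrightarrow> R j k \<Longrightarrow> p (j, k) \<cdot>\<^bsub>T\<^esub> p (i, j) = p (i, k)"
  "i \<in> M \<Longrightarrow> j \<in> M \<Longrightarrow> c i \<otimes>\<^bsub>T\<^esub> c j = c (i + j)"
  "i \<in> M \<Longrightarrow> j \<in> M \<Longrightarrow> k \<in> M \<Longrightarrow> l \<in> M \<Longrightarrow> R i j \<Longrightarrow> R k l \<Longrightarrow>
     p (i, j) \<boxtimes>\<^bsub>T\<^esub> p (k, l) = p (i + k, j + l)"
  "i \<in> M \<Longrightarrow> j \<in> M \<Longrightarrow> k \<in> M \<Longrightarrow> Asc T (c i) (c j) (c k) = p (i + j + k, i + j + k)"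
  "i \<in> M \<Longrightarrow> Lun T (c i) = p (i, i)"
  "i \<in> M \<Longrightarrow> Run T (c i) = p (i, i)"
  by (simp_all add: T_def closed)

lemma mor_iff [simp]: "f \<in> mor T x y \<longleftrightarrow> (\<exists>i\<in>M. \<exists>j\<in>M. R i j \<and> x = c i \<and> y = c j \<and> f = p (i, j))"
  by (auto simp: mor_def arrow_def closed)

lemma invertible_p [simp]: "i \<in> M \<Longrightarrow> invertible T (p (i, i))"
  unfolding invertible_def inverses_def by (rule exI[where x = "p (i, i)"]) (auto simp: refl)

lemma monoidal: "monoidal_category T"
proof -
  note [simp] = closed
  show ?thesis
  proof
    show "Asc T x y z \<in> mor T (x \<otimes>\<^bsub>T\<^esub> y \<otimes>\<^bsub>T\<^esub> z) (x \<otimes>\<^bsub>T\<^esub> (y \<otimes>\<^bsub>T\<^esub> z)) \<and> invertible T (Asc T x y z)"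
      if "x \<in> Ob T" "y \<in> Ob T" "z \<in> Ob T" for x y z
      using that by (auto simp: add.assoc)
    show "Dom T \<in> extensional (Ar T)" "Cod T \<in> extensional (Ar T)" "Idn T \<in> extensional (Ob T)"
      "Lun T \<in> extensional (Ob T)" "Run T \<in> extensional (Ob T)"
      by (simp_all add: T_def)
    show "g \<cdot>\<^bsub>T\<^esub> f = undefined" if "\<not> (f \<in> Ar T \<and> g \<in> Ar T \<and> Dom T g = Cod T f)" for f g
      using that by (auto simp: T_def)
    show "x \<otimes>\<^bsub>T\<^esub> y = undefined" if "\<not> (x \<in> Ob T \<and> y \<in> Ob T)" for x y
      using that by (auto simp: T_def)
    show "f \<boxtimes>\<^bsub>T\<^esub> g = undefined" if "\<not> (f \<in> Ar T \<and> g \<in> Ar T)" for f g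
      using that by (auto simp: T_def)
    show "Asc T x y z = undefined" if "\<not> (x \<in> Ob T \<and> y \<in> Ob T \<and> z \<in> Ob T)" for x y z
      using that by (auto simp: T_def)
    show "h \<cdot>\<^bsub>T\<^esub> (g \<cdot>\<^bsub>T\<^esub> f) = (h \<cdot>\<^bsub>T\<^esub> g) \<cdot>\<^bsub>T\<^esub> f"
      if fgh: "f \<in> mor T w x" "g \<in> mor T x y" "h \<in> mor T y z" for f g h w x y z
    proof -
      obtain i j k l where "i \<in> M" "j \<in> M" "k \<in> M" "l \<in> M" "R i j" "R j k" "R k l"
        "f = p (i, j)" "g = p (j, k)" "h = p (k, l)"
        using fgh by auto
      moreover from this have "R i k" "R j l" by (blast intro: trans)+
      ultimately show ?thesis by simp
    qed
    show "(g \<cdot>\<^bsub>T\<^esub> f) \<boxtimes>\<^bsub>T\<^esub> (g' \<cdot>\<^bsub>T\<^esub> f') = (g \<boxtimes>\<^bsub>T\<^esub> g') \<cdot>\<^bsub>T\<^esub> (f \<boxtimes>\<^bsub>T\<^esub> f')"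
      if fg: "f \<in> mor T x y" "g \<in> mor T y z" "f' \<in> mor T x' y'" "g' \<in> mor T y' z'"
      for f g x y z f' g' x' y' z'
    proof -
      obtain i j k i' j' k' where "i \<in> M" "j \<in> M" "k \<in> M" "i' \<in> M" "j' \<in> M" "k' \<in> M"
        "R i j" "R j k" "R i' j'" "R j' k'"
        "f = p (i, j)" "g = p (j, k)" "f' = p (i', j')" "g' = p (j', k')"
        using fg by auto
      moreover from this have "R i k" "R i' k'" by (blast intro: trans)+
      ultimately show ?thesis by simp
    qed
  qed (auto simp: arrow_def add.assoc intro: trans)
qed

text \<open>
  Into a thin monoidal category, a lax monoidal functor is a mere function on objects subject to
  inequalities; the coherence equations hold because parallel arrows are equal.
\<close>

definition lax :: "'v mon_cat \<Rightarrow> ('v \<Rightarrow> 'm) \<Rightarrow> 'v lax_fun" where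
  "lax U \<phi> = \<lparr>LSrc = U, LTrg = T, LOb = (\<lambda>x\<in>Ob U. c (\<phi> x)),
     LAr = (\<lambda>f\<in>Ar U. p (\<phi> (Dom U f), \<phi> (Cod U f))),
     LMu = (\<lambda>x y. if x \<in> Ob U \<and> y \<in> Ob U then p (\<phi> x + \<phi> y, \<phi> (x \<otimes>\<^bsub>U\<^esub> y)) else undefined),
     LEps = p (0, \<phi> \<I>\<^bsub>U\<^esub>)\<rparr>"

definition lax_map :: "'v mon_cat \<Rightarrow> ('v \<Rightarrow> 'm) \<Rightarrow> bool" where
  "lax_map U \<phi> \<longleftrightarrow> monoidal_category U \<and> (\<forall>x\<in>Ob U. \<phi> x \<in> M) \<and>
     (\<forall>f\<in>Ar U. R (\<phi> (Dom U f)) (\<phi> (Cod U f))) \<and>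
     (\<forall>x\<in>Ob U. \<forall>y\<in>Ob U. R (\<phi> x + \<phi> y) (\<phi> (x \<otimes>\<^bsub>U\<^esub> y))) \<and> R 0 (\<phi> \<I>\<^bsub>U\<^esub>)"

lemma lax_sel [simp]:
  "LSrc (lax U \<phi>) = U" "LTrg (lax U \<phi>) = T"
  "x \<in> Ob U \<Longrightarrow> LOb (lax U \<phi>) x = c (\<phi> x)"
  "f \<in> Ar U \<Longrightarrow> LAr (lax U \<phi>) f = p (\<phi> (Dom U f), \<phi> (Cod U f))"
  "x \<in> Ob U \<Longrightarrow> y \<in> Ob U \<Longrightarrow> LMu (lax U \<phi>) x y = p (\<phi> x + \<phi> y, \<phi> (x \<otimes>\<^bsub>U\<^esub> y))"
  "LEps (lax U \<phi>) = p (0, \<phi> \<I>\<^bsub>U\<^esub>)"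
  by (simp_all add: lax_def)

lemma lax_cong:
  assumes "monoidal_category U" "\<And>x. x \<in> Ob U \<Longrightarrow> \<phi> x = \<psi> x"
  shows "lax U \<phi> = lax U \<psi>"
proof -
  interpret U: monoidal_category U by fact
  show ?thesis
    by (auto simp: lax_def assms(2) U.dom U.cod U.unt U.ten_ob fun_eq_iff)
qed

text \<open>
  Each coherence equation is computed rather than derived from thinness, so the proof consists in
  supplying the inequality behind every arrow that occurs in one of the composites.
\<close>

lemma lax_monoidal_lax:
  assumes "lax_map U \<phi>"
  shows "lax_monoidal_functor (lax U \<phi>)"
proof -
  interpret U: monoidal_category U using assms by (simp add: lax_map_def)
  note [simp] = closed U.dom U.cod U.unt U.ten_ob
  have M [simp]: "x \<in> Ob U \<Longrightarrow> \<phi> x \<in> M" for x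
    using assms by (simp add: lax_map_def)
  have ar [simp]: "f \<in> Ar U \<Longrightarrow> R (\<phi> (Dom U f)) (\<phi> (Cod U f))" for f
    using assms by (simp add: lax_map_def)
  have mu [simp]: "x \<in> Ob U \<Longrightarrow> y \<in> Ob U \<Longrightarrow> R (\<phi> x + \<phi> y) (\<phi> (x \<otimes>\<^bsub>U\<^esub> y))" for x y
    using assms by (simp add: lax_map_def)
  have eps [simp]: "R 0 (\<phi> \<I>\<^bsub>U\<^esub>)"
    using assms by (simp add: lax_map_def)
  have idn [simp]: "Idn U x \<in> Ar U" "Dom U (Idn U x) = x" "Cod U (Idn U x) = x" if "x \<in> Ob U" for x
    using U.idn[OF that] by (auto simp: mor_def)
  have cmp [simp]: "g \<cdot>\<^bsub>U\<^esub> f \<in> Ar U" "Dom U (g \<cdot>\<^bsub>U\<^esub> f) = Dom U f" "Cod U (g \<cdot>\<^bsub>U\<^esub> f) = Cod U g"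
    if "f \<in> Ar U" "g \<in> Ar U" "Dom U g = Cod U f" for f g
    using U.cmp[of f "Dom U f" "Cod U f" g "Cod U g"] that by (auto simp: mor_def)
  have ten [simp]: "f \<boxtimes>\<^bsub>U\<^esub> g \<in> Ar U" "Dom U (f \<boxtimes>\<^bsub>U\<^esub> g) = Dom U f \<otimes>\<^bsub>U\<^esub> Dom U g"
    "Cod U (f \<boxtimes>\<^bsub>U\<^esub> g) = Cod U f \<otimes>\<^bsub>U\<^esub> Cod U g" if "f \<in> Ar U" "g \<in> Ar U" for f g
    using U.ten_ar[of f "Dom U f" "Cod U f" g "Dom U g" "Cod U g"] that by (auto simp: mor_def)
  have asc [simp]: "Asc U x y z \<in> Ar U" "Dom U (Asc U x y z) = x \<otimes>\<^bsub>U\<^esub> y \<otimes>\<^bsub>U\<^esub> z"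
    "Cod U (Asc U x y z) = x \<otimes>\<^bsub>U\<^esub> (y \<otimes>\<^bsub>U\<^esub> z)" if "x \<in> Ob U" "y \<in> Ob U" "z \<in> Ob U" for x y z
    using U.asc[OF that] by (auto simp: mor_def)
  have lun [simp]: "Lun U x \<in> Ar U" "Dom U (Lun U x) = \<I>\<^bsub>U\<^esub> \<otimes>\<^bsub>U\<^esub> x" "Cod U (Lun U x) = x"
    if "x \<in> Ob U" for x
    using U.lun[OF that] by (auto simp: mor_def)
  have run [simp]: "Run U x \<in> Ar U" "Dom U (Run U x) = x \<otimes>\<^bsub>U\<^esub> \<I>\<^bsub>U\<^esub>" "Cod U (Run U x) = x"
    if "x \<in> Ob U" for x
    using U.run[OF that] by (auto simp: mor_def)
  have cmp_R [simp]: "f \<in> Ar U \<Longrightarrow> g \<in> Ar U \<Longrightarrow> R (\<phi> (Dom U f) + \<phi> (Dom U g)) (\<phi> (Cod U f) + \<phi> (Cod U g))" for f g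
    by simp
  have ten_R [simp]: "f \<in> Ar U \<Longrightarrow> g \<in> Ar U \<Longrightarrow>
      R (\<phi> (Dom U f \<otimes>\<^bsub>U\<^esub> Dom U g)) (\<phi> (Cod U f \<otimes>\<^bsub>U\<^esub> Cod U g))" for f g
    using ar[of "f \<boxtimes>\<^bsub>U\<^esub> g"] by simp
  have asc_R [simp]: "x \<in> Ob U \<Longrightarrow> y \<in> Ob U \<Longrightarrow> z \<in> Ob U \<Longrightarrow>
      R (\<phi> (x \<otimes>\<^bsub>U\<^esub> y \<otimes>\<^bsub>U\<^esub> z)) (\<phi> (x \<otimes>\<^bsub>U\<^esub> (y \<otimes>\<^bsub>U\<^esub> z)))" for x y z
    using ar[of "Asc U x y z"] by simp
  have lun_R [simp]: "x \<in> Ob U \<Longrightarrow> R (\<phi> (\<I>\<^bsub>U\<^esub> \<otimes>\<^bsub>U\<^esub> x)) (\<phi> x)" for x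
    using ar[of "Lun U x"] by simp
  have run_R [simp]: "x \<in> Ob U \<Longrightarrow> R (\<phi> (x \<otimes>\<^bsub>U\<^esub> \<I>\<^bsub>U\<^esub>)) (\<phi> x)" for x
    using ar[of "Run U x"] by simp
  have l3 [simp]: "x \<in> Ob U \<Longrightarrow> y \<in> Ob U \<Longrightarrow> z \<in> Ob U \<Longrightarrow>
      R (\<phi> x + \<phi> y + \<phi> z) (\<phi> (x \<otimes>\<^bsub>U\<^esub> y) + \<phi> z)" for x y z
    by simp
  have r3 [simp]: "x \<in> Ob U \<Longrightarrow> y \<in> Ob U \<Longrightarrow> z \<in> Ob U \<Longrightarrow>
      R (\<phi> x + (\<phi> y + \<phi> z)) (\<phi> x + \<phi> (y \<otimes>\<^bsub>U\<^esub> z))" for x y z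
    by simp
  have lu [simp]: "x \<in> Ob U \<Longrightarrow> R (\<phi> x) (\<phi> \<I>\<^bsub>U\<^esub> + \<phi> x)" for x
    using add_mono[OF eps refl[OF M], of x] by simp
  have ru [simp]: "x \<in> Ob U \<Longrightarrow> R (\<phi> x) (\<phi> x + \<phi> \<I>\<^bsub>U\<^esub>)" for x
    using add_mono[OF refl[OF M] eps, of x] by simp
  have t1 [simp]: "x \<in> Ob U \<Longrightarrow> y \<in> Ob U \<Longrightarrow> z \<in> Ob U \<Longrightarrow>
      R (\<phi> (x \<otimes>\<^bsub>U\<^esub> y) + \<phi> z) (\<phi> (x \<otimes>\<^bsub>U\<^esub> (y \<otimes>\<^bsub>U\<^esub> z)))" for x y z
    by (rule trans[OF mu asc_R]) simp_all
  have t2 [simp]: "x \<in> Ob U \<Longrightarrow> R (\<phi> \<I>\<^bsub>U\<^esub> + \<phi> x) (\<phi> x)" "x \<in> Ob U \<Longrightarrow> R (\<phi> x + \<phi> \<I>\<^bsub>U\<^esub>) (\<phi> x)" for x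
    by (rule trans[OF mu lun_R]; simp) (rule trans[OF mu run_R]; simp)
  have t3 [simp]: "x \<in> Ob U \<Longrightarrow> y \<in> Ob U \<Longrightarrow> z \<in> Ob U \<Longrightarrow>
      R (\<phi> x + (\<phi> y + \<phi> z)) (\<phi> (x \<otimes>\<^bsub>U\<^esub> (y \<otimes>\<^bsub>U\<^esub> z)))" for x y z
    by (rule trans[OF r3 mu]) simp_all
  note [simp] = r3[unfolded add.assoc[symmetric]] t3[unfolded add.assoc[symmetric]]
  have [simp]: "R (\<phi> (Cod U f)) (\<phi> (Cod U g))" "R (\<phi> (Dom U f)) (\<phi> (Cod U g))"
    if "f \<in> Ar U" "g \<in> Ar U" "Dom U g = Cod U f" for f g
    using that ar[of g] trans[OF ar[of f], of "\<phi> (Cod U g)"] by simp_all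
  show ?thesis
    unfolding lax_monoidal_functor_def Let_def lax_sel(1,2)
    by (intro conjI ballI allI impI)
      (auto simp: U.monoidal_category_axioms monoidal lax_def[of U \<phi>] add.assoc[symmetric])
qed


lemma lax_eq_lax:
  assumes F: "lax_monoidal_functor F" "LTrg F = T"
  shows "F = lax (LSrc F) (\<lambda>x. inv c (LOb F x))"
proof -
  note [simp] = closed
  note F' = F(1)[unfolded lax_monoidal_functor_def Let_def F(2)]
  have ob: "\<exists>i\<in>M. LOb F x = c i" if "x \<in> Ob (LSrc F)" for x
    using F' that by auto
  interpret U: monoidal_category "LSrc F" using F' by blast
  have *: "LOb F x = c (inv c (LOb F x))" if "x \<in> Ob (LSrc F)" for x
    using ob[OF that] by auto
  show ?thesis
  proof (rule lax_fun.equality)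
    show "LOb F = LOb (lax (LSrc F) (\<lambda>x. inv c (LOb F x)))"
      using F' * by (auto simp: lax_def fun_eq_iff PiE_def extensional_def)
    show "LAr F = LAr (lax (LSrc F) (\<lambda>x. inv c (LOb F x)))"
    proof
      fix f show "LAr F f = LAr (lax (LSrc F) (\<lambda>x. inv c (LOb F x))) f"
      proof (cases "f \<in> Ar (LSrc F)")
        case True
        then have "LAr F f \<in> mor T (LOb F (Dom (LSrc F) f)) (LOb F (Cod (LSrc F) f))"
          using F' by blast
        then show ?thesis using True by auto
      next
        case False
        have "LAr F \<in> extensional (Ar (LSrc F))" using F' by (auto simp: PiE_def)
        with False show ?thesis by (simp add: lax_def extensional_def)
      qed
    qed
    show "LMu F = LMu (lax (LSrc F) (\<lambda>x. inv c (LOb F x)))"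
    proof (intro ext)
      fix x y show "LMu F x y = LMu (lax (LSrc F) (\<lambda>x. inv c (LOb F x))) x y"
      proof (cases "x \<in> Ob (LSrc F) \<and> y \<in> Ob (LSrc F)")
        case True
        then have "LMu F x y \<in> mor T (LOb F x \<otimes>\<^bsub>T\<^esub> LOb F y) (LOb F (x \<otimes>\<^bsub>LSrc F\<^esub> y))"
          using F' by blast
        then show ?thesis using True ob[of x] ob[of y] by auto
      next
        case False
        then show ?thesis using F' by (auto simp: lax_def)
      qed
    qed
    have "LEps F \<in> mor T \<I>\<^bsub>T\<^esub> (LOb F \<I>\<^bsub>LSrc F\<^esub>)"
      using F' by blast
    then show "LEps F = LEps (lax (LSrc F) (\<lambda>x. inv c (LOb F x)))"
      by auto
  qed (simp_all add: F(2))
qed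

lemma lax_functor_eqI:
  assumes "lax_monoidal_functor F" "LTrg F = T" "lax_monoidal_functor G" "LTrg G = T"
    "LSrc F = LSrc G" "\<And>x. x \<in> Ob (LSrc F) \<Longrightarrow> LOb F x = LOb G x"
  shows "F = G"
proof -
  have U: "monoidal_category (LSrc F)" using assms(1) by (simp add: lax_monoidal_functor_def Let_def)
  have "F = lax (LSrc F) (\<lambda>x. inv c (LOb F x))" by (rule lax_eq_lax) fact+
  also have "\<dots> = lax (LSrc F) (\<lambda>x. inv c (LOb G x))" by (rule lax_cong[OF U]) (simp add: assms(6))
  also have "\<dots> = G" unfolding assms(5) by (rule lax_eq_lax[symmetric]) fact+
  finally show ?thesis .
qed

text \<open>
  Composition with a functor into a thin category only composes the functions on objects; this
  reduces equations between composites to equations between functions.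
\<close>

lemma comp_lax_lax:
  assumes F: "lax_monoidal_functor F" and \<psi>: "lax_map (LTrg F) \<psi>"
  shows "comp_lax (lax (LTrg F) \<psi>) F = lax (LSrc F) (\<lambda>x. \<psi> (LOb F x))"
proof -
  note [simp] = closed
  note F' = F[unfolded lax_monoidal_functor_def Let_def]
  interpret U: monoidal_category "LSrc F" using F' by blast
  interpret W: monoidal_category "LTrg F" using F' by blast
  have ob [simp]: "LOb F x \<in> Ob (LTrg F)" if "x \<in> Ob (LSrc F)" for x
    using F' that by auto
  have [simp]: "LAr F f \<in> Ar (LTrg F)" "Dom (LTrg F) (LAr F f) = LOb F (Dom (LSrc F) f)"
    "Cod (LTrg F) (LAr F f) = LOb F (Cod (LSrc F) f)" if "f \<in> Ar (LSrc F)" for f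
    using F' that by (auto simp: mor_def)
  have [simp]: "LMu F x y \<in> Ar (LTrg F)"
    "Dom (LTrg F) (LMu F x y) = LOb F x \<otimes>\<^bsub>LTrg F\<^esub> LOb F y"
    "Cod (LTrg F) (LMu F x y) = LOb F (x \<otimes>\<^bsub>LSrc F\<^esub> y)"
    if "x \<in> Ob (LSrc F)" "y \<in> Ob (LSrc F)" for x y
    using F' that by (auto simp: mor_def)
  have [simp]: "LEps F \<in> Ar (LTrg F)" "Dom (LTrg F) (LEps F) = \<I>\<^bsub>LTrg F\<^esub>"
    "Cod (LTrg F) (LEps F) = LOb F \<I>\<^bsub>LSrc F\<^esub>"
    using F' by (auto simp: mor_def)
  have M [simp]: "x \<in> Ob (LTrg F) \<Longrightarrow> \<psi> x \<in> M" for x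
    using \<psi> by (simp add: lax_map_def)
  have ar: "f \<in> Ar (LTrg F) \<Longrightarrow> R (\<psi> (Dom (LTrg F) f)) (\<psi> (Cod (LTrg F) f))" for f
    using \<psi> by (simp add: lax_map_def)
  have [simp]: "R (\<psi> (LOb F x \<otimes>\<^bsub>LTrg F\<^esub> LOb F y)) (\<psi> (LOb F (x \<otimes>\<^bsub>LSrc F\<^esub> y)))"
    if "x \<in> Ob (LSrc F)" "y \<in> Ob (LSrc F)" for x y
    using ar[of "LMu F x y"] that by simp
  have [simp]: "R (\<psi> \<I>\<^bsub>LTrg F\<^esub>) (\<psi> (LOb F \<I>\<^bsub>LSrc F\<^esub>))"
    using ar[of "LEps F"] by simp
  have [simp]: "x \<in> Ob (LTrg F) \<Longrightarrow> y \<in> Ob (LTrg F) \<Longrightarrow> R (\<psi> x + \<psi> y) (\<psi> (x \<otimes>\<^bsub>LTrg F\<^esub> y))" for x y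
    using \<psi> by (simp add: lax_map_def)
  have [simp]: "R 0 (\<psi> \<I>\<^bsub>LTrg F\<^esub>)"
    using \<psi> by (simp add: lax_map_def)
  note [simp] = U.dom U.cod U.unt U.ten_ob W.unt W.ten_ob
  show ?thesis
    by (rule lax_fun.equality) (auto simp: comp_lax_def lax_def[of "LSrc F"] fun_eq_iff)
qed


text \<open>
  Components with the same domain and codomain are equal by thinness, so a transformation built
  componentwise can be identified with a given one from the types of its components alone.
\<close>

lemma monoidal_natural_eqI:
  assumes \<alpha>: "monoidal_natural \<alpha>" "LTrg (MSrc \<alpha>) = T"
    and \<beta>: "MCmp \<beta> \<in> extensional (Ob (LSrc (MSrc \<alpha>)))"
      "\<And>x. x \<in> Ob (LSrc (MSrc \<alpha>)) \<Longrightarrow> MCmp \<beta> x \<in> mor T (LOb (MSrc \<alpha>) x) (LOb (MTrg \<alpha>) x)"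
    and eq: "MSrc \<beta> = MSrc \<alpha>" "MTrg \<beta> = MTrg \<alpha>"
  shows "\<beta> = \<alpha>"
proof (rule mon_nt.equality)
  show "MCmp \<beta> = MCmp \<alpha>"
  proof
    fix x show "MCmp \<beta> x = MCmp \<alpha> x"
    proof (cases "x \<in> Ob (LSrc (MSrc \<alpha>))")
      case True
      then have "MCmp \<alpha> x \<in> mor T (LOb (MSrc \<alpha>) x) (LOb (MTrg \<alpha>) x)"
        using \<alpha> by (simp add: monoidal_natural_def Let_def)
      with \<beta>(2)[OF True] show ?thesis by auto
    next
      case False
      have "MCmp \<alpha> \<in> extensional (Ob (LSrc (MSrc \<alpha>)))"
        using \<alpha>(1) by (simp only: monoidal_natural_def Let_def)
      with \<beta>(1) False show ?thesis by (simp add: extensional_def)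
    qed
  qed
qed (simp_all add: eq)

lemma monoidal_natural_identity:
  assumes F: "lax_monoidal_functor F" "LTrg F = T"
  shows "monoidal_natural \<lparr>MSrc = F, MTrg = F, MCmp = (\<lambda>x\<in>Ob (LSrc F). Idn T (LOb F x))\<rparr>"
proof -
  note [simp] = closed
  note F' = F(1)[unfolded lax_monoidal_functor_def Let_def F(2)]
  interpret U: monoidal_category "LSrc F" using F' by blast
  note [simp] = U.dom U.cod U.unt U.ten_ob
  have ob: "\<exists>i\<in>M. LOb F x = c i" if "x \<in> Ob (LSrc F)" for x
    using F' that by auto
  have ar: "LAr F f \<in> mor T (LOb F (Dom (LSrc F) f)) (LOb F (Cod (LSrc F) f))" if "f \<in> Ar (LSrc F)" for f
    using F' that by blast
  have mu: "LMu F x y \<in> mor T (LOb F x \<otimes>\<^bsub>T\<^esub> LOb F y) (LOb F (x \<otimes>\<^bsub>LSrc F\<^esub> y))"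
    if "x \<in> Ob (LSrc F)" "y \<in> Ob (LSrc F)" for x y
    using F' that by blast
  have eps: "LEps F \<in> mor T \<I>\<^bsub>T\<^esub> (LOb F \<I>\<^bsub>LSrc F\<^esub>)"
    using F' by blast
  have "LAr F f \<cdot>\<^bsub>T\<^esub> Idn T (LOb F (Dom (LSrc F) f)) = Idn T (LOb F (Cod (LSrc F) f)) \<cdot>\<^bsub>T\<^esub> LAr F f"
    if "f \<in> Ar (LSrc F)" for f
    using ar[OF that] by auto
  moreover have "Idn T (LOb F (x \<otimes>\<^bsub>LSrc F\<^esub> y)) \<cdot>\<^bsub>T\<^esub> LMu F x y =
      LMu F x y \<cdot>\<^bsub>T\<^esub> (Idn T (LOb F x) \<boxtimes>\<^bsub>T\<^esub> Idn T (LOb F y))"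
    if "x \<in> Ob (LSrc F)" "y \<in> Ob (LSrc F)" for x y
    using mu[OF that] ob[OF that(1)] ob[OF that(2)] by auto
  moreover have "Idn T (LOb F \<I>\<^bsub>LSrc F\<^esub>) \<cdot>\<^bsub>T\<^esub> LEps F = LEps F"
    using eps by auto
  moreover have "Idn T (LOb F x) \<in> mor T (LOb F x) (LOb F x)" if "x \<in> Ob (LSrc F)" for x
    using ob[OF that] by auto
  ultimately show ?thesis
    unfolding monoidal_natural_def Let_def mon_nt.select_convs F(2)
    using F(1) by (simp del: mor_iff)
qed

lemma large:
  assumes "\<And>S. S \<subseteq> range c \<union> range p \<Longrightarrow> in_universe el U S"
  shows "T \<in> large_mon_cats el U"
proof -
  have "Ar T \<subseteq> range c \<union> range p" by (auto simp: arrow_def)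
  moreover have "Ob T \<subseteq> range c \<union> range p" by auto
  ultimately show ?thesis using assms monoidal by (simp add: large_mon_cats_def del: T_sel(1,2))
qed

end


section \<open>The parallel pair\<close>

locale parallel_pair =
  fixes c :: "int \<Rightarrow> 'v" and p :: "int \<times> int \<Rightarrow> 'v" and el :: "'v \<Rightarrow> 'v set" and U :: 'v
  assumes inj_c: "inj c" and inj_p: "inj p"
    and univ: "\<And>S. S \<subseteq> range c \<union> range p \<Longrightarrow> in_universe el U S"
begin

sublocale V: thin_monoidal c p UNIV "(=)"
  by unfold_locales (auto simp: inj_c inj_p)

sublocale W: thin_monoidal c p UNIV "\<lambda>_ _. True"
  by unfold_locales (auto simp: inj_c inj_p)

sublocale E: thin_monoidal c p "{0}" "(=)"
  by unfold_locales (auto simp: inj_c inj_p)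

definition left :: "'v lax_fun" where
  "left = W.lax V.T (\<lambda>x. 0)"

definition right_map :: "'v \<Rightarrow> int" where
  "right_map x = (if inv c x \<in> {-1, 0, 1} then 0 else 1)"

definition right :: "'v lax_fun" where
  "right = W.lax V.T right_map"

definition incl :: "'v lax_fun" where
  "incl = V.lax E.T (inv c)"

lemma lax_map_left: "W.lax_map V.T (\<lambda>x. 0)"
  and lax_map_right: "W.lax_map V.T right_map"
  by (simp_all add: W.lax_map_def V.monoidal)

lemma lax_map_incl: "V.lax_map E.T (inv c)"
  by (auto simp: V.lax_map_def E.monoidal E.arrow_def)

lemma lax_map_trivial: "monoidal_category D \<Longrightarrow> E.lax_map D (\<lambda>x. 0)"
  by (auto simp: E.lax_map_def)

lemma sel [simp]:
  "LSrc left = V.T" "LTrg left = W.T" "LSrc right = V.T" "LTrg right = W.T"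
  "LSrc incl = E.T" "LTrg incl = V.T"
  by (simp_all add: left_def right_def incl_def)

lemma large_T: "V.T \<in> large_mon_cats el U" "W.T \<in> large_mon_cats el U" "E.T \<in> large_mon_cats el U"
  by (rule V.large W.large E.large, erule univ)+

lemma large_funs:
  "left \<in> large_lax_funs el U" "right \<in> large_lax_funs el U" "incl \<in> large_lax_funs el U"
  using W.lax_monoidal_lax[OF lax_map_left] W.lax_monoidal_lax[OF lax_map_right]
    V.lax_monoidal_lax[OF lax_map_incl] large_T
  by (simp_all add: large_lax_funs_def) (simp_all add: left_def right_def incl_def)

lemma comp_left:
  assumes "lax_monoidal_functor h" "LTrg h = V.T"
  shows "comp_lax left h = W.lax (LSrc h) (\<lambda>x. 0)"
  using W.comp_lax_lax[of h "\<lambda>x. 0"] lax_map_left assms by (simp add: left_def)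

lemma comp_right:
  assumes "lax_monoidal_functor h" "LTrg h = V.T"
  shows "comp_lax right h = W.lax (LSrc h) (\<lambda>x. right_map (LOb h x))"
  using W.comp_lax_lax[of h right_map] lax_map_right assms by (simp add: right_def)

lemma comp_incl:
  assumes "lax_monoidal_functor h" "LTrg h = E.T"
  shows "comp_lax incl h = V.lax (LSrc h) (\<lambda>x. inv c (LOb h x))"
  using V.comp_lax_lax[of h "inv c"] lax_map_incl assms by (simp add: incl_def)

text \<open>
  The structure map at \<open>(x, x)\<close> is an arrow of a discrete category, so \<open>h (x \<otimes> x)\<close> is twice
  \<open>h x\<close>; both lie in \<open>{-1, 0, 1}\<close>, and 0 is the only element of that set whose double stays in it.
\<close>

lemma equalized_trivial:
  assumes h: "lax_monoidal_functor h" "LTrg h = V.T" and eq: "comp_lax left h = comp_lax right h"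
    and x: "x \<in> Ob (LSrc h)"
  shows "LOb h x = c 0"
proof -
  note h' = h(1)[unfolded lax_monoidal_functor_def Let_def h(2)]
  interpret D: monoidal_category "LSrc h" using h' by blast
  have S: "inv c (LOb h y) \<in> {-1, 0, 1}" if "y \<in> Ob (LSrc h)" for y
  proof -
    have "LOb (comp_lax left h) y = LOb (comp_lax right h) y" by (simp only: eq)
    then have "right_map (LOb h y) = 0"
      using that by (simp add: comp_left[OF h] comp_right[OF h])
    then show ?thesis by (auto simp: right_map_def split: if_splits)
  qed
  have "LMu h x x \<in> mor V.T (LOb h x \<otimes>\<^bsub>V.T\<^esub> LOb h x) (LOb h (x \<otimes>\<^bsub>LSrc h\<^esub> x))"
    using h' x by blast
  moreover obtain i where i: "LOb h x = c i" using lax_functor_ob[OF h(1) x] h(2) by auto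
  ultimately have "LOb h (x \<otimes>\<^bsub>LSrc h\<^esub> x) = c (i + i)" by auto
  then show ?thesis using S[OF x] S[OF D.ten_ob[OF x x]] i by auto
qed

lemma into_E_unique:
  assumes "lax_monoidal_functor u" "LTrg u = E.T" "lax_monoidal_functor v" "LTrg v = E.T"
    "LSrc u = LSrc v"
  shows "u = v"
proof (rule E.lax_functor_eqI[OF assms])
  fix x assume "x \<in> Ob (LSrc u)"
  then have "LOb u x \<in> Ob E.T" "LOb v x \<in> Ob E.T"
    using lax_functor_ob[of u x] lax_functor_ob[of v x] assms by simp_all
  then show "LOb u x = LOb v x" by simp
qed

lemma MonCAT_sel:
  "Cell1 (MonCAT el U) = large_lax_funs el U"
  "F \<in> large_lax_funs el U \<Longrightarrow> Src1 (MonCAT el U) F = LSrc F"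
  "F \<in> large_lax_funs el U \<Longrightarrow> Trg1 (MonCAT el U) F = LTrg F"
  "F \<in> large_lax_funs el U \<Longrightarrow> G \<in> large_lax_funs el U \<Longrightarrow> LSrc G = LTrg F \<Longrightarrow>
     Comp1 (MonCAT el U) G F = comp_lax G F"
  by (simp_all add: MonCAT_def)

lemma incl_is_equalizer: "is_equalizer (MonCAT el U) left right incl"
proof -
  have incl: "comp_lax left incl = comp_lax right incl"
    unfolding comp_left[OF V.lax_monoidal_lax[OF lax_map_incl, folded incl_def] sel(6)]
      comp_right[OF V.lax_monoidal_lax[OF lax_map_incl, folded incl_def] sel(6)]
    by (rule W.lax_cong) (auto simp: E.monoidal right_map_def incl_def)
  have one: "\<exists>!u. u \<in> hom1 (MonCAT el U) (Src1 (MonCAT el U) h) (Src1 (MonCAT el U) incl) \<and>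
      Comp1 (MonCAT el U) incl u = h"
    if h: "h \<in> large_lax_funs el U" "Trg1 (MonCAT el U) h = Src1 (MonCAT el U) left"
      and eq: "Comp1 (MonCAT el U) left h = Comp1 (MonCAT el U) right h" for h
  proof (rule ex1I)
    have h2: "LTrg h = V.T" using h large_funs by (simp add: MonCAT_sel)
    have h3: "lax_monoidal_functor h" "LSrc h \<in> large_mon_cats el U"
      using h by (auto simp: large_lax_funs_def)
    have D: "monoidal_category (LSrc h)" using h3 by (simp add: lax_monoidal_functor_def Let_def)
    have eq: "comp_lax left h = comp_lax right h"
      using eq h large_funs h2 by (simp add: MonCAT_sel)
    let ?u = "E.lax (LSrc h) (\<lambda>x. 0)"
    have u: "lax_monoidal_functor ?u" by (rule E.lax_monoidal_lax[OF lax_map_trivial[OF D]])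
    then have u': "?u \<in> large_lax_funs el U" using h3 large_T by (simp add: large_lax_funs_def)
    have "comp_lax incl ?u = V.lax (LSrc h) (\<lambda>x. inv c (LOb h x))"
      unfolding comp_incl[OF u E.lax_sel(2)] unfolding E.lax_sel(1)
      by (rule V.lax_cong[OF D]) (simp add: equalized_trivial[OF h3(1) h2 eq])
    also have "\<dots> = h" by (rule V.lax_eq_lax[OF h3(1) h2, symmetric])
    finally show "?u \<in> hom1 (MonCAT el U) (Src1 (MonCAT el U) h) (Src1 (MonCAT el U) incl) \<and>
        Comp1 (MonCAT el U) incl ?u = h"
      using u' h large_funs by (simp add: hom1_def MonCAT_sel)
    fix v assume "v \<in> hom1 (MonCAT el U) (Src1 (MonCAT el U) h) (Src1 (MonCAT el U) incl) \<and>
        Comp1 (MonCAT el U) incl v = h"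
    then have "v \<in> large_lax_funs el U" "LSrc v = LSrc h" "LTrg v = E.T"
      using h large_funs by (auto simp add: hom1_def MonCAT_sel)
    then show "v = ?u" using into_E_unique[OF _ _ u] by (auto simp: large_lax_funs_def)
  qed
  have two: "\<exists>!\<psi>. \<psi> \<in> hom2 (MonCAT el U) u v \<and> HComp (MonCAT el U) (Id2 (MonCAT el U) incl) \<psi> = \<theta>"
    if uv: "u \<in> large_lax_funs el U" "v \<in> large_lax_funs el U"
        "Src1 (MonCAT el U) u = Src1 (MonCAT el U) v"
        "Trg1 (MonCAT el U) u = Src1 (MonCAT el U) incl"
        "Trg1 (MonCAT el U) v = Src1 (MonCAT el U) incl"
      and \<theta>: "\<theta> \<in> hom2 (MonCAT el U) (Comp1 (MonCAT el U) incl u) (Comp1 (MonCAT el U) incl v)"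
    for u v \<theta>
  proof -
    have u: "lax_monoidal_functor u" "LTrg u = E.T" and v: "lax_monoidal_functor v" "LTrg v = E.T"
      and src: "LSrc u = LSrc v"
      using uv large_funs by (auto simp: large_lax_funs_def MonCAT_sel)
    have "v = u" by (rule into_E_unique[OF v u src[symmetric]])
    have uob: "LOb u x = c 0" if "x \<in> Ob (LSrc u)" for x
      using lax_functor_ob[OF u(1) that] u(2) by simp
    have \<theta>': "monoidal_natural \<theta>" "MSrc \<theta> = comp_lax incl u" "MTrg \<theta> = comp_lax incl u"
      using \<theta> uv large_funs u \<open>v = u\<close>
      by (auto simp: hom2_def MonCAT_def large_mon_nts_def)
    let ?\<psi> = "\<lparr>MSrc = u, MTrg = u, MCmp = (\<lambda>x\<in>Ob (LSrc u). Idn E.T (LOb u x))\<rparr>"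
    have \<psi>: "monoidal_natural ?\<psi>" by (rule E.monoidal_natural_identity[OF u])
    have I: "Id2 (MonCAT el U) incl =
        \<lparr>MSrc = incl, MTrg = incl, MCmp = (\<lambda>x\<in>Ob E.T. Idn V.T (LOb incl x))\<rparr>" (is "_ = ?I")
      using large_funs by (simp add: MonCAT_def)
    have "monoidal_natural ?I"
      using V.monoidal_natural_identity[of incl] large_funs by (simp add: large_lax_funs_def)
    then have I2: "?I \<in> large_mon_nts el U" using large_funs by (simp add: large_mon_nts_def)
    have \<psi>2: "?\<psi> \<in> large_mon_nts el U" using \<psi> uv by (simp add: large_mon_nts_def)
    have H: "HComp (MonCAT el U) ?I ?\<psi> = \<theta>"
    proof (rule V.monoidal_natural_eqI[OF \<theta>'(1)])
      show "LTrg (MSrc \<theta>) = V.T" by (simp add: \<theta>' comp_lax_def)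
      show "MSrc (HComp (MonCAT el U) ?I ?\<psi>) = MSrc \<theta>" "MTrg (HComp (MonCAT el U) ?I ?\<psi>) = MTrg \<theta>"
        using I2 \<psi>2 \<theta>' u by (simp_all add: MonCAT_def)
      show "MCmp (HComp (MonCAT el U) ?I ?\<psi>) \<in> extensional (Ob (LSrc (MSrc \<theta>)))"
        using I2 \<psi>2 \<theta>' u by (simp add: MonCAT_def comp_lax_def)
      fix x assume "x \<in> Ob (LSrc (MSrc \<theta>))"
      then have "x \<in> Ob (LSrc u)" by (simp add: \<theta>' comp_lax_def)
      moreover from this have "LOb (comp_lax incl u) x = c 0"
        by (simp add: comp_incl[OF u] uob)
      moreover have "LOb incl (c 0) = c 0" "LAr incl (p (0, 0)) = p (0, 0)"
        by (simp_all add: incl_def)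
      ultimately show "MCmp (HComp (MonCAT el U) ?I ?\<psi>) x \<in> mor V.T (LOb (MSrc \<theta>) x) (LOb (MTrg \<theta>) x)"
        using I2 \<psi>2 \<theta>' u by (simp add: MonCAT_def uob)
    qed
    show ?thesis
    proof (rule ex1I)
      show "?\<psi> \<in> hom2 (MonCAT el U) u v \<and> HComp (MonCAT el U) (Id2 (MonCAT el U) incl) ?\<psi> = \<theta>"
        using \<psi>2 H \<open>v = u\<close> unfolding I by (simp add: hom2_def MonCAT_def)
      fix \<chi> assume "\<chi> \<in> hom2 (MonCAT el U) u v \<and> HComp (MonCAT el U) (Id2 (MonCAT el U) incl) \<chi> = \<theta>"
      then have \<chi>: "monoidal_natural \<chi>" "MSrc \<chi> = u" "MTrg \<chi> = u"
        using \<open>v = u\<close> by (auto simp: hom2_def MonCAT_def large_mon_nts_def)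
      have "?\<psi> = \<chi>"
        by (rule E.monoidal_natural_eqI[OF \<chi>(1)]) (simp_all add: \<chi> u uob)
      then show "\<chi> = ?\<psi>" ..
    qed
  qed
  show ?thesis
    unfolding is_equalizer_def
    by (intro conjI ballI impI; (elim conjE)?)
      (use large_funs incl in \<open>simp_all add: MonCAT_sel\<close>, use one two in \<open>simp_all add: MonCAT_sel\<close>)
qed

text \<open>
  The hom-objects are differences of a potential \<open>d\<close> on the objects, so that composition
  \<open>X(y,z) + X(x,y) = X(x,z)\<close> is an equality of integers, that is, an identity arrow of the discrete
  category.
\<close>

definition two_object_cat :: "'v \<Rightarrow> 'v \<Rightarrow> 'v v_cat" where
  "two_object_cat a b =
     (let d = (\<lambda>x. if x = a then 0 else 1)
      in \<lparr>VOb = {a, b},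
          VHom = (\<lambda>x y. if x \<in> {a, b} \<and> y \<in> {a, b} then c (d y - d x) else undefined),
          VCmp = (\<lambda>x y z. if x \<in> {a, b} \<and> y \<in> {a, b} \<and> z \<in> {a, b}
                    then p (d z - d x, d z - d x) else undefined),
          VIdn = (\<lambda>x\<in>{a, b}. p (0, 0))\<rparr>)"

lemma enriched_two_object_cat: "enriched_category V.T (two_object_cat a b)"
  unfolding enriched_category_def
  by (auto simp: two_object_cat_def)

text \<open>
  Differences of two values of \<open>d\<close> lie in \<open>{-1, 0, 1}\<close>, where the two lax functors agree.
\<close>

lemma base_cat_eq: "base_cat left (two_object_cat a b) = base_cat right (two_object_cat a b)"
  by (rule v_cat.equality)
    (auto simp: base_cat_def two_object_cat_def fun_eq_iff left_def right_def right_map_def)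

text \<open>
  Base change along the inclusion of \<open>{0}\<close> makes every hom-object 0, while the hom-object from \<open>a\<close> to
  \<open>b\<close> is 1.
\<close>

lemma base_cat_incl_neq:
  assumes "a \<noteq> b" and Y: "enriched_category E.T Y"
  shows "base_cat incl Y \<noteq> two_object_cat a b"
proof
  assume eq: "base_cat incl Y = two_object_cat a b"
  have "VOb (base_cat incl Y) = {a, b}" unfolding eq by (simp add: two_object_cat_def)
  then have ab: "a \<in> VOb Y" "b \<in> VOb Y" by (auto simp: base_cat_def)
  then have "VHom Y a b \<in> Ob E.T" using Y by (simp only: enriched_category_def)
  then have "VHom (base_cat incl Y) a b = c 0" using ab by (auto simp: base_cat_def incl_def)
  then show False using \<open>a \<noteq> b\<close> unfolding eq by (simp add: two_object_cat_def)
qed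

end


section \<open>Right 2-adjoints and factorizations through equalizers\<close>

lemma two_functor_hom1:
  assumes "two_functor F" "f \<in> hom1 (FSrc F) x y"
  shows "F1 F f \<in> hom1 (FTrg F) (F0 F x) (F0 F y)"
  using assms by (auto simp: two_functor_def Let_def hom1_def)

lemma two_functor_comp1:
  assumes "two_functor F" "f \<in> hom1 (FSrc F) x y" "g \<in> hom1 (FSrc F) y z"
  shows "F1 F (Comp1 (FSrc F) g f) = Comp1 (FTrg F) (F1 F g) (F1 F f)"
proof -
  have "composable1 (FSrc F) g f" using assms(2,3) by (simp add: composable1_def hom1_def)
  with assms(1) show ?thesis unfolding two_functor_def Let_def by blast
qed

lemma two_natural_hom1:
  assumes "two_natural \<eta>" "x \<in> Cell0 (FSrc (NSrc \<eta>))"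
  shows "NCmp \<eta> x \<in> hom1 (FTrg (NSrc \<eta>)) (F0 (NSrc \<eta>) x) (F0 (NTrg \<eta>) x)"
  using assms unfolding two_natural_def Let_def by blast

lemma two_natural_square:
  assumes "two_natural \<eta>" "f \<in> hom1 (FSrc (NSrc \<eta>)) x y"
  shows "Comp1 (FTrg (NSrc \<eta>)) (F1 (NTrg \<eta>) f) (NCmp \<eta> x) =
    Comp1 (FTrg (NSrc \<eta>)) (NCmp \<eta> y) (F1 (NSrc \<eta>) f)"
proof -
  have "f \<in> Cell1 (FSrc (NSrc \<eta>))" "Src1 (FSrc (NSrc \<eta>)) f = x" "Trg1 (FSrc (NSrc \<eta>)) f = y"
    using assms(2) by (auto simp: hom1_def)
  then show ?thesis using assms(1) unfolding two_natural_def Let_def by blast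
qed

text \<open>
  The existence half of the statement that right 2-adjoints preserve equalizers. The transpose
  \<open>\<epsilon> \<cdot> L h\<close> of \<open>h\<close> equalizes \<open>f\<close> and \<open>g\<close>, hence factors through \<open>e\<close>, and transposing the factor gives
  \<open>u\<close>.
\<close>

lemma right_2adjoint_factorization:
  assumes R: "has_left_2adjoint R" and eq: "is_equalizer (FSrc R) f g e"
    and h: "h \<in> hom1 (FTrg R) x (F0 R (Src1 (FSrc R) f))"
    and fh: "Comp1 (FTrg R) (F1 R f) h = Comp1 (FTrg R) (F1 R g) h"
  shows "\<exists>u. u \<in> hom1 (FTrg R) x (F0 R (Src1 (FSrc R) e)) \<and> Comp1 (FTrg R) (F1 R e) u = h"
proof -
  define K where "K = FSrc R"
  define D where "D = FTrg R"
  obtain L \<eta> \<epsilon> where L: "FSrc L = D" "FTrg L = K" "two_functor L" "two_functor R"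
    and \<eta>: "two_natural \<eta>" "NSrc \<eta> = id_fun D" "NTrg \<eta> = comp_fun R L"
    and \<epsilon>: "two_natural \<epsilon>" "NSrc \<epsilon> = comp_fun L R" "NTrg \<epsilon> = id_fun K"
    and tri: "\<And>y. y \<in> Cell0 K \<Longrightarrow> Comp1 D (F1 R (NCmp \<epsilon> y)) (NCmp \<eta> (F0 R y)) = Id1 D (F0 R y)"
    using R unfolding has_left_2adjoint_def K_def D_def by metis
  interpret K: two_category K using L(4) by (simp add: two_functor_def Let_def K_def)
  interpret D: two_category D using L(4) by (simp add: two_functor_def Let_def D_def)
  note R1 = two_functor_hom1[OF L(4), folded K_def D_def]
    and R2 = two_functor_comp1[OF L(4), folded K_def D_def]
    and L1 = two_functor_hom1[OF L(3), unfolded L(1,2)]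
    and L2 = two_functor_comp1[OF L(3), unfolded L(1,2)]
  define y where "y = Src1 K f"
  define z where "z = Trg1 K f"
  have fg: "f \<in> hom1 K y z" "g \<in> hom1 K y z" "e \<in> hom1 K (Src1 K e) y"
    using eq by (auto simp: is_equalizer_def hom1_def K_def y_def z_def)
  have lift: "\<exists>!u. u \<in> hom1 K (Src1 K k) (Src1 K e) \<and> Comp1 K e u = k"
    if "k \<in> hom1 K w y" "Comp1 K f k = Comp1 K g k" for k w
  proof -
    have "\<forall>h\<in>Cell1 K. Trg1 K h = Src1 K f \<and> Comp1 K f h = Comp1 K g h \<longrightarrow>
        (\<exists>!u. u \<in> hom1 K (Src1 K h) (Src1 K e) \<and> Comp1 K e u = h)"
      using eq unfolding is_equalizer_def K_def by blast
    moreover have "k \<in> Cell1 K" "Trg1 K k = Src1 K f" using that(1) by (simp_all add: hom1_def y_def)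
    ultimately show ?thesis using that(2) by blast
  qed
  have h: "h \<in> hom1 D x (F0 R y)" using h by (simp add: D_def y_def K_def)
  have x: "x \<in> Cell0 D" using h D.src1 by (auto simp: hom1_def)
  have yz: "y \<in> Cell0 K" "z \<in> Cell0 K" using fg K.src1 K.trg1 by (auto simp: hom1_def)
  have \<epsilon>1: "NCmp \<epsilon> w \<in> hom1 K (F0 L (F0 R w)) w" if "w \<in> Cell0 K" for w
    using two_natural_hom1[OF \<epsilon>(1), of w] that
    by (simp add: \<epsilon>(2,3) comp_fun_def id_fun_def L K_def[symmetric])
  have \<epsilon>2: "Comp1 K k (NCmp \<epsilon> v) = Comp1 K (NCmp \<epsilon> w) (F1 L (F1 R k))" if "k \<in> hom1 K v w" for k v w
    using two_natural_square[OF \<epsilon>(1), of k v w] that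
    by (simp add: \<epsilon>(2,3) comp_fun_def id_fun_def L K_def[symmetric] hom1_def)
  have \<eta>1: "NCmp \<eta> x \<in> hom1 D x (F0 R (F0 L x))"
    using two_natural_hom1[OF \<eta>(1), of x] x by (simp add: \<eta>(2,3) comp_fun_def id_fun_def L)
  have \<eta>2: "Comp1 D (F1 R (F1 L h)) (NCmp \<eta> x) = Comp1 D (NCmp \<eta> (F0 R y)) h"
    using two_natural_square[OF \<eta>(1), of h x "F0 R y"] h
    by (simp add: \<eta>(2,3) comp_fun_def id_fun_def L hom1_def)
  have \<eta>3: "NCmp \<eta> (F0 R y) \<in> hom1 D (F0 R y) (F0 R (F0 L (F0 R y)))"
    using two_natural_hom1[OF \<eta>(1), of "F0 R y"] D.trg1[of h] h
    by (auto simp: \<eta>(2,3) comp_fun_def id_fun_def L hom1_def)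
  let ?k = "Comp1 K (NCmp \<epsilon> y) (F1 L h)"
  have k: "?k \<in> hom1 K (F0 L x) y"
    by (rule K.comp1[OF L1[OF h] \<epsilon>1[OF yz(1)]])
  have fk: "Comp1 K j ?k = Comp1 K (NCmp \<epsilon> z) (F1 L (Comp1 D (F1 R j) h))"
    if j: "j \<in> hom1 K y z" for j
  proof -
    have "Comp1 K j ?k = Comp1 K (Comp1 K (NCmp \<epsilon> z) (F1 L (F1 R j))) (F1 L h)"
      by (simp add: K.comp1_assoc[OF L1[OF h] \<epsilon>1[OF yz(1)] j] \<epsilon>2[OF j])
    also have "\<dots> = Comp1 K (NCmp \<epsilon> z) (Comp1 K (F1 L (F1 R j)) (F1 L h))"
      by (rule K.comp1_assoc[OF L1[OF h] L1[OF R1[OF j]] \<epsilon>1[OF yz(2)], symmetric])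
    finally show ?thesis by (simp add: L2[OF h R1[OF j]])
  qed
  have "Comp1 K f ?k = Comp1 K g ?k"
    using fh by (simp add: fk[OF fg(1)] fk[OF fg(2)] D_def)
  from lift[OF k this] k obtain u where u: "u \<in> hom1 K (F0 L x) (Src1 K e)" "Comp1 K e u = ?k"
    by (auto simp: hom1_def)
  let ?w = "Comp1 D (F1 R u) (NCmp \<eta> x)"
  have "?w \<in> hom1 D x (F0 R (Src1 K e))"
    by (rule D.comp1[OF \<eta>1 R1[OF u(1)]])
  moreover have "Comp1 D (F1 R e) ?w = h"
  proof -
    have "Comp1 D (F1 R e) ?w = Comp1 D (F1 R ?k) (NCmp \<eta> x)"
      by (simp add: D.comp1_assoc[OF \<eta>1 R1[OF u(1)] R1[OF fg(3)]] R2[OF u(1) fg(3), symmetric] u(2))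
    also have "\<dots> = Comp1 D (F1 R (NCmp \<epsilon> y)) (Comp1 D (F1 R (F1 L h)) (NCmp \<eta> x))"
      by (simp add: R2[OF L1[OF h] \<epsilon>1[OF yz(1)]]
          D.comp1_assoc[OF \<eta>1 R1[OF L1[OF h]] R1[OF \<epsilon>1[OF yz(1)]]])
    also have "\<dots> = Comp1 D (Id1 D (F0 R y)) h"
      by (simp add: \<eta>2 D.comp1_assoc[OF h \<eta>3 R1[OF \<epsilon>1[OF yz(1)]]] tri[OF yz(1)])
    also have "\<dots> = h" by (rule D.comp1_id_left[OF h])
    finally show ?thesis .
  qed
  ultimately show ?thesis unfolding K_def D_def by blast
qed


section \<open>The 2-functor from the point that names an object\<close>

text \<open>
  The terminal 2-category, with cells in arbitrary types. All its operations are constant at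
  \<open>undefined\<close>, which also serves as the name of its unique cells; the required values outside the
  domains of the operations then come for free.
\<close>

definition point_cat :: "('o, 'a, 'c) two_cat" where
  "point_cat = \<lparr>Cell0 = {undefined}, Cell1 = {undefined}, Cell2 = {undefined},
     Src1 = (\<lambda>_. undefined), Trg1 = (\<lambda>_. undefined), Src2 = (\<lambda>_. undefined), Trg2 = (\<lambda>_. undefined),
     Id1 = (\<lambda>_. undefined), Comp1 = (\<lambda>_ _. undefined), Id2 = (\<lambda>_. undefined),
     VComp = (\<lambda>_ _. undefined), HComp = (\<lambda>_ _. undefined)\<rparr>"

lemma point_cat_sel [simp]:
  "Cell0 point_cat = {undefined}" "Cell1 point_cat = {undefined}" "Cell2 point_cat = {undefined}"
  by (simp_all add: point_cat_def)

lemma two_category_point: "two_category point_cat"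
  by unfold_locales (auto simp: point_cat_def hom1_def hom2_def)

definition point_fun :: "('p, 'b, 'd) two_cat \<Rightarrow> 'p \<Rightarrow> ('o, 'a, 'c, 'p, 'b, 'd) two_fun" where
  "point_fun D y = \<lparr>FSrc = point_cat, FTrg = D, F0 = (\<lambda>_\<in>{undefined}. y),
     F1 = (\<lambda>_\<in>{undefined}. Id1 D y), F2 = (\<lambda>_\<in>{undefined}. Id2 D (Id1 D y))\<rparr>"

lemma point_fun_sel [simp]:
  "FSrc (point_fun D y) = point_cat" "FTrg (point_fun D y) = D" "F0 (point_fun D y) undefined = y"
  by (simp_all add: point_fun_def)

lemma two_functor_point:
  assumes "two_category D" "y \<in> Cell0 D"
  shows "two_functor (point_fun D y)"
proof -
  interpret D: two_category D by fact
  note i = D.id1[OF assms(2)]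
  have i1: "Id1 D y \<in> Cell1 D" using i by (simp add: hom1_def)
  note j = D.id2[OF i1]
  show ?thesis
    using i j D.comp1_id_left[OF i] D.vcomp_id_left[OF j] D.hcomp_id_left[OF j i] assms two_category_point
    by (auto simp: two_functor_def point_fun_def point_cat_def hom1_def hom2_def Let_def
        composable1_def vcomposable_def hcomposable_def)
qed

text \<open>
  Since \<open>point_fun D y\<close> depends on nothing but \<open>D\<close> and \<open>y\<close>, two 2-functors with the same codomain that
  agree on one object have equal composites with the 2-functor naming that object.
\<close>

lemma comp_fun_point:
  assumes "two_functor G" "y \<in> Cell0 (FSrc G)"
  shows "comp_fun G (point_fun (FSrc G) y) = point_fun (FTrg G) (F0 G y)"
proof -
  have i: "Id1 (FSrc G) y \<in> Cell1 (FSrc G)"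
    using assms two_category.id1[of "FSrc G" y] by (auto simp: two_functor_def Let_def hom1_def)
  then have "F1 G (Id1 (FSrc G) y) = Id1 (FTrg G) (F0 G y)"
    "F2 G (Id2 (FSrc G) (Id1 (FSrc G) y)) = Id2 (FTrg G) (Id1 (FTrg G) (F0 G y))"
    using assms by (simp_all add: two_functor_def Let_def)
  then show ?thesis
    by (simp add: comp_fun_def point_fun_def point_cat_def fun_eq_iff)
qed


section \<open>Failure of preservation\<close>

lemma slice_sel:
  "Cell1 (slice L X) = slice1 L X"
  "(p, q, h) \<in> slice1 L X \<Longrightarrow> Src1 (slice L X) (p, q, h) = p"
  "(p, q, h) \<in> slice1 L X \<Longrightarrow> Trg1 (slice L X) (p, q, h) = q"
  "(p, q, h) \<in> slice1 L X \<Longrightarrow> (q, r, k) \<in> slice1 L X \<Longrightarrow>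
     Comp1 (slice L X) (q, r, k) (p, q, h) = (p, r, Comp1 L k h)"
  by (simp_all add: slice_def)

lemma TwoCAT_sel:
  "Cell1 (TwoCAT el U) = large_two_funs el U"
  "F \<in> large_two_funs el U \<Longrightarrow> Src1 (TwoCAT el U) F = FSrc F"
  "F \<in> large_two_funs el U \<Longrightarrow> Trg1 (TwoCAT el U) F = FTrg F"
  "F \<in> large_two_funs el U \<Longrightarrow> G \<in> large_two_funs el U \<Longrightarrow> FSrc G = FTrg F \<Longrightarrow>
     Comp1 (TwoCAT el U) G F = comp_fun G F"
  by (simp_all add: TwoCAT_def)

lemma slice1_TwoCAT:
  "(p, q, h) \<in> slice1 (TwoCAT el U) X \<longleftrightarrow>
     p \<in> large_two_funs el U \<and> q \<in> large_two_funs el U \<and> h \<in> large_two_funs el U \<and>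
     FTrg p = X \<and> FTrg q = X \<and> FSrc h = FSrc p \<and> FTrg h = FSrc q \<and> comp_fun q h = p"
  by (auto simp: slice1_def hom1_def TwoCAT_sel)

lemma base_change_sel:
  "FSrc (base_change el U1 F) = VCat el U1 (LSrc F)"
  "FTrg (base_change el U1 F) = VCat el U1 (LTrg F)"
  "X \<in> small_v_cats el U1 (LSrc F) \<Longrightarrow> F0 (base_change el U1 F) X = base_cat F X"
  by (simp_all add: base_change_def)

context parallel_pair
begin

lemma universe_sized_singleton: "universe_sized el U {x}"
proof -
  have "in_universe el U {c 0}" by (rule univ) auto
  then obtain y where y: "y \<in> el U" "el y = {c 0}" by (auto simp: in_universe_def)
  have "bij_betw (\<lambda>_. c 0) {x} (el y)" by (simp add: y bij_betw_def)
  with y(1) show ?thesis unfolding universe_sized_def by blast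
qed

lemma large_point: "point_cat \<in> large_two_cats el U"
  by (simp add: large_two_cats_def two_category_point universe_sized_singleton)

lemma large_point_fun:
  assumes D: "D \<in> large_two_cats el U" and y: "y \<in> Cell0 D"
  shows "point_fun D y \<in> large_two_funs el U"
proof -
  have "two_functor (point_fun D y)"
    by (rule two_functor_point[OF _ y]) (use D in \<open>simp add: large_two_cats_def\<close>)
  then show ?thesis by (simp add: large_two_funs_def large_point D)
qed

text \<open>
  That base change along the three functors is 2-functorial between large 2-categories is
  contained in the hypotheses that the triples are 1-cells of the slice.
\<close>

lemma slice_no_factorization:
  assumes ab: "in_universe el U1 {a, b}" "a \<noteq> b"
    and l: "(q, r, base_change el U1 left) \<in> slice1 (TwoCAT el U) X"
    and r: "(q, r, base_change el U1 right) \<in> slice1 (TwoCAT el U) X"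
    and i: "(s, q, base_change el U1 incl) \<in> slice1 (TwoCAT el U) X"
  shows "\<exists>h\<in>slice1 (TwoCAT el U) X. Trg1 (slice (TwoCAT el U) X) h = q \<and>
    Comp1 (slice (TwoCAT el U) X) (q, r, base_change el U1 left) h =
      Comp1 (slice (TwoCAT el U) X) (q, r, base_change el U1 right) h \<and>
    \<not> (\<exists>u. u \<in> hom1 (slice (TwoCAT el U) X) (Src1 (slice (TwoCAT el U) X) h) s \<and>
      Comp1 (slice (TwoCAT el U) X) (s, q, base_change el U1 incl) u = h)"
proof -
  let ?L = "base_change el U1 left" and ?R = "base_change el U1 right" and ?I = "base_change el U1 incl"
    and ?Z = "two_object_cat a b" and ?P = "slice (TwoCAT el U) X"
  note l' = l[unfolded slice1_TwoCAT] and r' = r[unfolded slice1_TwoCAT] and i' = i[unfolded slice1_TwoCAT]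
  have L: "two_functor ?L" "two_functor ?R" "two_functor q" "FSrc ?L = FSrc q" "FSrc ?R = FSrc q"
    "FSrc q \<in> large_two_cats el U" "X \<in> large_two_cats el U"
    using l' r' by (auto simp: large_two_funs_def)
  have q: "FSrc q = VCat el U1 V.T" using L(4) by (simp add: base_change_def)
  have Z': "?Z \<in> small_v_cats el U1 V.T"
    using ab enriched_two_object_cat by (simp add: small_v_cats_def) (simp add: two_object_cat_def)
  then have Z: "?Z \<in> Cell0 (FSrc q)" by (simp add: q VCat_def)
  define h :: "('v v_cat, 'v v_fun, 'v v_nt, 'v v_cat, 'v v_fun, 'v v_nt) two_fun"
    where "h = point_fun (FSrc q) ?Z"
  have h: "h \<in> large_two_funs el U"
    unfolding h_def by (rule large_point_fun[OF L(6) Z])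
  have qh: "comp_fun q h = point_fun X (F0 q ?Z)"
    using comp_fun_point[OF L(3) Z] l' by (simp add: h_def)
  have "F0 q ?Z \<in> Cell0 X" using L(3) Z l' unfolding two_functor_def Let_def by blast
  then have qh': "comp_fun q h \<in> large_two_funs el U"
    unfolding qh by (rule large_point_fun[OF L(7)])
  have fh: "FTrg h = FSrc q" "FSrc h = FSrc (comp_fun q h)" by (simp_all add: h_def comp_fun_def)
  have H: "(comp_fun q h, q, h) \<in> slice1 (TwoCAT el U) X"
    using h qh' fh l' by (simp add: slice1_TwoCAT) (simp add: qh)
  have "comp_fun ?L h = point_fun (VCat el U1 W.T) (base_cat left ?Z)"
    using comp_fun_point[OF L(1), unfolded L(4), OF Z] Z' unfolding h_def base_change_sel sel by (simp add: base_change_sel)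
  moreover have "comp_fun ?R h = point_fun (VCat el U1 W.T) (base_cat right ?Z)"
    using comp_fun_point[OF L(2), unfolded L(5), OF Z] Z' unfolding h_def base_change_sel sel by (simp add: base_change_sel)
  ultimately have eq: "comp_fun ?L h = comp_fun ?R h" by (simp only: base_cat_eq)
  have LR: "?L \<in> large_two_funs el U" "?R \<in> large_two_funs el U" "?I \<in> large_two_funs el U"
    using l' r' i' by blast+
  have "Comp1 (TwoCAT el U) ?L h = comp_fun ?L h" "Comp1 (TwoCAT el U) ?R h = comp_fun ?R h"
    by (rule TwoCAT_sel(4)[OF h LR(1)] TwoCAT_sel(4)[OF h LR(2)], simp only: L fh)+
  then have eq: "Comp1 ?P (q, r, ?L) (comp_fun q h, q, h) = Comp1 ?P (q, r, ?R) (comp_fun q h, q, h)"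
    by (simp only: slice_sel(4)[OF H l] slice_sel(4)[OF H r] eq)
  have no: False if u: "u \<in> hom1 ?P (comp_fun q h) s" "Comp1 ?P (s, q, ?I) u = (comp_fun q h, q, h)" for u
  proof -
    obtain p' s' k where uk: "u = (p', s', k)" by (metis prod_cases3)
    have u1: "(p', s', k) \<in> slice1 (TwoCAT el U) X"
      using u(1) unfolding hom1_def slice_sel(1) uk by blast
    have ps: "p' = comp_fun q h" "s' = s"
      using u(1) unfolding hom1_def uk by (simp_all add: slice_sel(2,3)[OF u1])
    note u2 = u1[unfolded ps(2)]
    have k: "k \<in> large_two_funs el U" "FSrc k = FSrc p'" "FTrg k = FSrc s"
      using u2[unfolded slice1_TwoCAT] by blast+
    have "FSrc s = FSrc ?I" using i' by simp
    with k have FT: "FSrc k = point_cat" "FTrg k = VCat el U1 E.T" "FSrc ?I = FTrg k"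
      by (simp_all only: ps(1) qh point_fun_sel base_change_sel sel)
    have "Comp1 (TwoCAT el U) ?I k = h"
      using u(2) unfolding uk ps(2) slice_sel(4)[OF u2 i] by simp
    then have Ik: "comp_fun ?I k = h"
      using TwoCAT_sel(4)[OF k(1) LR(3) FT(3)] by simp
    have "two_functor k" using k(1) by (simp add: large_two_funs_def)
    then have "F0 k undefined \<in> Cell0 (VCat el U1 E.T)"
      unfolding two_functor_def Let_def FT by auto
    then have Y: "F0 k undefined \<in> small_v_cats el U1 E.T" by (simp add: VCat_def)
    then have "F0 (comp_fun ?I k) undefined = base_cat incl (F0 k undefined)"
      by (simp add: comp_fun_def FT(1) base_change_sel)
    then have "base_cat incl (F0 k undefined) = ?Z" by (simp add: Ik) (simp add: h_def)
    moreover have "enriched_category E.T (F0 k undefined)" using Y by (simp add: small_v_cats_def)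
    ultimately show False using base_cat_incl_neq[OF ab(2)] by blast
  qed
  show ?thesis
    by (intro bexI[OF _ H] conjI eq notI; (elim exE conjE)?)
      (use no in \<open>simp_all only: slice_sel(2,3)[OF H]\<close>)
qed

lemma terminal_lift_sel:
  "FSrc (terminal_lift R t) = FSrc R"
  "FTrg (terminal_lift R t) = slice (FTrg R) (F0 R t)"
  "f \<in> Cell1 (FSrc R) \<Longrightarrow> F1 (terminal_lift R t) f =
     (F1 R (bang (FSrc R) t (Src1 (FSrc R) f)), F1 R (bang (FSrc R) t (Trg1 (FSrc R) f)), F1 R f)"
  by (simp_all add: terminal_lift_def Let_def)

lemma Enr_sel:
  "FSrc (Enr el U1 U) = MonCAT el U" "FTrg (Enr el U1 U) = TwoCAT el U"
  "F \<in> large_lax_funs el U \<Longrightarrow> F1 (Enr el U1 U) F = base_change el U1 F"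
  by (simp_all add: Enr_def)

lemma Enr1_no_factorization:
  fixes U1 t :: _
  defines "R \<equiv> terminal_lift (Enr el U1 U) t"
  assumes ab: "in_universe el U1 {a, b}" "a \<noteq> b"
    and mem: "F1 R left \<in> Cell1 (FTrg R)" "F1 R right \<in> Cell1 (FTrg R)" "F1 R incl \<in> Cell1 (FTrg R)"
  obtains h where "h \<in> Cell1 (FTrg R)" "Trg1 (FTrg R) h = Src1 (FTrg R) (F1 R left)"
    "Comp1 (FTrg R) (F1 R left) h = Comp1 (FTrg R) (F1 R right) h"
    "\<not> (\<exists>u. u \<in> hom1 (FTrg R) (Src1 (FTrg R) h) (Src1 (FTrg R) (F1 R incl)) \<and>
       Comp1 (FTrg R) (F1 R incl) u = h)"
proof -
  let ?X = "F0 (Enr el U1 U) t"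
  let ?b = "\<lambda>D. F1 (Enr el U1 U) (bang (MonCAT el U) t D)"
  have F: "F1 R F = (?b (LSrc F), ?b (LTrg F), base_change el U1 F)" if "F \<in> large_lax_funs el U" for F
    using that unfolding R_def
    by (simp only: terminal_lift_sel Enr_sel MonCAT_sel)
  have T: "FTrg R = slice (TwoCAT el U) ?X"
    by (simp only: R_def terminal_lift_sel Enr_sel)
  note F' = F[OF large_funs(1), unfolded sel] F[OF large_funs(2), unfolded sel] F[OF large_funs(3), unfolded sel]
  note m = mem[unfolded F' T slice_sel(1)]
  show thesis
    by (rule bexE[OF slice_no_factorization[OF ab m]], elim conjE,
        rule that[unfolded F' T slice_sel(1) slice_sel(2)[OF m(1)] slice_sel(2)[OF m(3)]])
qed

lemma Enr1_not_preserving: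
  assumes ab: "in_universe el U1 {a, b}" "a \<noteq> b"
  shows "\<not> is_equalizer (FTrg (terminal_lift (Enr el U1 U) t))
    (F1 (terminal_lift (Enr el U1 U) t) left) (F1 (terminal_lift (Enr el U1 U) t) right)
    (F1 (terminal_lift (Enr el U1 U) t) incl)" (is "\<not> is_equalizer ?S ?l ?r ?i")
proof
  assume eq: "is_equalizer ?S ?l ?r ?i"
  then have "?l \<in> Cell1 ?S" "?r \<in> Cell1 ?S" "?i \<in> Cell1 ?S" by (simp_all add: is_equalizer_def)
  then obtain h where
    h: "h \<in> Cell1 ?S" "Trg1 ?S h = Src1 ?S ?l" "Comp1 ?S ?l h = Comp1 ?S ?r h"
    "\<not> (\<exists>u. u \<in> hom1 ?S (Src1 ?S h) (Src1 ?S ?i) \<and> Comp1 ?S ?i u = h)"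
    by (rule Enr1_no_factorization[OF ab]) (rule that)
  have "\<exists>!u. u \<in> hom1 ?S (Src1 ?S h) (Src1 ?S ?i) \<and> Comp1 ?S ?i u = h"
    using eq h(1-3) by (simp add: is_equalizer_def)
  with h(4) show False by blast
qed

text \<open>
  The object \<open>t\<close> is arbitrary because a parametric right 2-adjoint may use any terminal object.
\<close>

lemma Enr1_no_left_2adjoint:
  assumes ab: "in_universe el U1 {a, b}" "a \<noteq> b"
  shows "\<not> has_left_2adjoint (terminal_lift (Enr el U1 U) t)" (is "\<not> has_left_2adjoint ?R")
proof
  assume adj: "has_left_2adjoint ?R"
  then have R: "two_functor ?R" unfolding has_left_2adjoint_def by blast
  have K: "FSrc ?R = MonCAT el U" by (simp only: terminal_lift_sel Enr_sel)
  have R1: "F1 ?R F \<in> Cell1 (FTrg ?R)" "Src1 (FTrg ?R) (F1 ?R F) = F0 ?R (LSrc F)"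
    if "F \<in> large_lax_funs el U" for F
    using two_functor_hom1[OF R, of F "LSrc F" "LTrg F"] that
    unfolding K by (simp_all add: hom1_def MonCAT_sel)
  let ?S = "FTrg ?R" and ?l = "F1 ?R left" and ?r = "F1 ?R right" and ?i = "F1 ?R incl"
  obtain h where
    h: "h \<in> Cell1 ?S" "Trg1 ?S h = Src1 ?S ?l" "Comp1 ?S ?l h = Comp1 ?S ?r h"
    "\<not> (\<exists>u. u \<in> hom1 ?S (Src1 ?S h) (Src1 ?S ?i) \<and> Comp1 ?S ?i u = h)"
    by (rule Enr1_no_factorization[OF ab R1(1)[OF large_funs(1)] R1(1)[OF large_funs(2)]
        R1(1)[OF large_funs(3)]]) (rule that)
  have "h \<in> hom1 ?S (Src1 ?S h) (F0 ?R (Src1 (FSrc ?R) left))"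
    using h large_funs by (simp add: hom1_def R1 K MonCAT_sel)
  from right_2adjoint_factorization[OF adj incl_is_equalizer[folded K] this h(3)] h(4) show False
    using large_funs by (auto simp: K MonCAT_sel R1)
qed

end


theorem mainTheorem5:
  fixes el :: "'v \<Rightarrow> 'v set" and U1 U2 :: 'v
  assumes "nested_universes el U1 U2"
  shows "(\<exists>f g e. is_equalizer (MonCAT el U2) f g e \<and>
            \<not> is_equalizer (FTrg (Enr1 el U1 U2))
                (F1 (Enr1 el U1 U2) f) (F1 (Enr1 el U1 U2) g) (F1 (Enr1 el U1 U2) e)) \<and>
         \<not> parametric_right_2adjoint (Enr el U1 U2)"
proof -
  obtain x where x: "x \<in> el U1" "infinite (el x)"
    using assms by (auto simp: nested_universes_def grothendieck_universe_def)
  obtain f :: "nat \<Rightarrow> 'v" where f: "inj f" "range f \<subseteq> el x"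
    using infinite_countable_subset[OF x(2)] by blast
  have U1: "in_universe el U1 S" if "S \<subseteq> el x" for S
    using assms x(1) that by (simp add: nested_universes_def grothendieck_universe_def)
  have "x \<in> el U2"
    using assms x(1) by (auto simp: nested_universes_def grothendieck_universe_def)
  then have U2: "in_universe el U2 S" if "S \<subseteq> el x" for S
    using assms that by (simp add: nested_universes_def grothendieck_universe_def)
  \<comment> \<open>A countable subset of one infinite set of the universe holds all names of integers and pairs.\<close>
  interpret parallel_pair "f \<circ> to_nat" "f \<circ> to_nat" el U2
  proof
    show "inj (f \<circ> (to_nat :: int \<Rightarrow> nat))" "inj (f \<circ> (to_nat :: int \<times> int \<Rightarrow> nat))"
      using f(1) by (auto intro: inj_compose)
    show "in_universe el U2 S"
      if "S \<subseteq> range (f \<circ> (to_nat :: int \<Rightarrow> nat)) \<union> range (f \<circ> (to_nat :: int \<times> int \<Rightarrow> nat))" for S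
      by (rule U2) (use that f(2) in auto)
  qed
  have ab: "in_universe el U1 {f 0, f 1}" "f 0 \<noteq> f 1"
    by (rule U1) (use f in \<open>auto simp: inj_eq\<close>)
  show ?thesis
    using incl_is_equalizer Enr1_not_preserving[OF ab] Enr1_no_left_2adjoint[OF ab]
    unfolding parametric_right_2adjoint_def by blast
qed

end
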